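(* Let $m\geq 22$ be an integer and let $G\in \mathcal{G}(m,\theta_{1,2,3})\setminus \{S_{\frac{m+3}{2},2}\}$, i.e. $G$ is a $\theta_{1,2,3}$-free graph with exactly $m$ edges and no isolated vertices, and (when $m$ is odd) $G\not\cong S_{\frac{m+3}{2},2}$. Then $$\rho(G)\leq \begin{cases}\rho(F_{m,1}), & \text{if } m \text{ is even},\\ \rho(F_{m,2}), & \text{if } m \text{ is odd},\end{cases}$$ where $\rho(F_{m,t})$ is the largest root of $x^4-mx^2-(m-t-1)x+\frac{t}{2}(m-t-1)=0$ for $t=1$ (with $m$ even) and $t=2$ (with $m$ odd). Moreover, equality holds if and only if $G\cong F_{m,1}$ when $m$ is even, respectively $G\cong F_{m,2}$ when $m$ is odd.
   Context: All graphs are finite and simple. $\rho(G)$ denotes the spectral radius of the adjacency matrix of $G$. The size of a graph is its number of edges. A graph is $F$-free if it does not contain a (not necessarily induced) subgraph isomorphic to $F$. $\mathcal{G}(m,F)$ denotes the set of $F$-free graphs of size $m$ without isolated vertices (up to isomorphism). For positive integers $p\le q\le r$ with $q\ge 2$, $\theta_{p,q,r}$ is the graph formed by three internally disjoint paths of lengths $p,q,r$ with the same pair of endpoints; so $\theta_{1,2,3}$ is a 5-cycle together with one chord. For $1\le k\le n$, $S_{n,k}=K_k\triangledown\overline{K}_{n-k}$ is the graph of order $n$ obtained by joining every vertex of the complete graph $K_k$ to $n-k$ isolated vertices. For $m-t$ odd, $F_{m,t}$ is the graph of size $m$ obtained from $S_{\frac{m-t+3}{2},2}$ by joining one vertex of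 maximum degree to $t$ new isolated vertices (i.e. attaching $t$ pendant vertices to it). The graph $S_{\frac{m+3}{2},2}$ has $m$ edges and is defined only for odd $m$; for even $m$ nothing is removed from $\mathcal{G}(m,\theta_{1,2,3})$. *)

theory Defs
  imports
    "Graph_Theory.Digraph_Isomorphism"
    "Jordan_Normal_Form.Spectral_Radius"
begin

text \<open>
  Finite simple graphs are the symmetric loop-free digraphs of the locale \<open>pair_graph\<close>: an
  undirected edge \<open>uv\<close> is the pair of arcs \<open>(u, v)\<close> and \<open>(v, u)\<close>.
\<close>

definition edge_set :: "'a pair_pre_digraph \<Rightarrow> 'a set set" where
  "edge_set G = {{u, v} | u v. (u, v) \<in> parcs G}"

definition isomorphic :: "'a pair_pre_digraph \<Rightarrow> 'b pair_pre_digraph \<Rightarrow> bool" where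
  "isomorphic G H \<longleftrightarrow> digraph_iso (with_proj G) (with_proj H)"

lemma isomorphic_iff:
  assumes "pair_wf_digraph G"
  shows "isomorphic G H \<longleftrightarrow>
    (\<exists>f. bij_betw f (pverts G) (pverts H) \<and> parcs H = (\<lambda>(u, v). (f u, f v)) ` parcs G)"
proof
  assume "isomorphic G H"
  then obtain h where h: "pre_digraph.digraph_isomorphism (with_proj G) h"
    and H: "with_proj H = app_iso h (with_proj G)"
    by (auto simp: isomorphic_def digraph_iso_def)
  have V: "pverts H = iso_verts h ` pverts G"
    and A: "parcs H = iso_arcs h ` parcs G"
    and T: "iso_tail h = fst" "iso_head h = snd"
    using H by (auto simp: with_proj_def app_iso_def)
  have "iso_arcs h e = (iso_verts h (fst e), iso_verts h (snd e))" if "e \<in> parcs G" for e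
    using h that by (auto simp: pre_digraph.digraph_isomorphism_def T prod_eq_iff)
  then have "parcs H = (\<lambda>(u, v). (iso_verts h u, iso_verts h v)) ` parcs G"
    unfolding A by (intro image_cong) (auto split: prod.splits)
  then show "\<exists>f. bij_betw f (pverts G) (pverts H) \<and> parcs H = (\<lambda>(u, v). (f u, f v)) ` parcs G"
    using h V by (intro exI[of _ "iso_verts h"])
      (auto simp: pre_digraph.digraph_isomorphism_def bij_betw_def)
next
  assume "\<exists>f. bij_betw f (pverts G) (pverts H) \<and> parcs H = (\<lambda>(u, v). (f u, f v)) ` parcs G"
  then obtain f where f: "bij_betw f (pverts G) (pverts H)"
    and A: "parcs H = (\<lambda>(u, v). (f u, f v)) ` parcs G" by blast
  interpret pair_wf_digraph G by fact
  let ?h = "\<lparr>iso_verts = f, iso_arcs = (\<lambda>(u, v). (f u, f v)), iso_head = snd, iso_tail = fst\<rparr>"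
  have "inj_on (\<lambda>(u, v). (f u, f v)) (parcs G)"
    using f by (auto simp: inj_on_def bij_betw_def dest: in_arcsD1 in_arcsD2)
  then have "pre_digraph.digraph_isomorphism (with_proj G) ?h"
    using f wf_digraph_axioms by (auto simp: pre_digraph.digraph_isomorphism_def bij_betw_def)
  moreover have "with_proj H = app_iso ?h (with_proj G)"
    using f A by (auto simp: with_proj_def app_iso_def bij_betw_def)
  ultimately show "isomorphic G H"
    unfolding isomorphic_def digraph_iso_def by blast
qed

definition graph_free :: "'b pair_pre_digraph \<Rightarrow> 'a pair_pre_digraph \<Rightarrow> bool" where
  "graph_free F G \<longleftrightarrow> (\<nexists>H. subgraph (with_proj H) (with_proj G) \<and> isomorphic H F)"

definition no_isolated :: "'a pair_pre_digraph \<Rightarrow> bool" where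
  "no_isolated G \<longleftrightarrow> (\<forall>u \<in> pverts G. \<exists>v. (u, v) \<in> parcs G)"

text \<open>
  \<open>\<G>(m, F)\<close>, with vertices in the type \<open>'a\<close>. Isomorphic graphs are not identified; membership
  is invariant under isomorphism.
\<close>

definition free_graphs :: "nat \<Rightarrow> 'b pair_pre_digraph \<Rightarrow> 'a pair_pre_digraph set" where
  "free_graphs m F =
    {G. pair_graph G \<and> no_isolated G \<and> card (edge_set G) = m \<and> graph_free F G}"

definition adj_matrix :: "'a pair_pre_digraph \<Rightarrow> 'a list \<Rightarrow> complex mat" where
  "adj_matrix G vs =
    mat (length vs) (length vs) (\<lambda>(i, j). if (vs ! i, vs ! j) \<in> parcs G then 1 else 0)"

text \<open>
  \<open>\<rho>(G)\<close>. The enumeration of the vertices is immaterial, see \<open>rho_eq\<close> below. For the graph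
  without vertices the value of \<open>rho\<close> is unspecified.
\<close>

definition rho :: "'a pair_pre_digraph \<Rightarrow> real" where
  "rho G = spectral_radius (adj_matrix G (SOME vs. distinct vs \<and> set vs = pverts G))"

definition path_arcs :: "'a list \<Rightarrow> ('a \<times> 'a) set" where
  "path_arcs vs = set (zip vs (tl vs))"

text \<open>
  \<open>\<theta>\<^sub>p\<^sub>,\<^sub>q\<^sub>,\<^sub>r\<close>, with common endpoints 0 and 1; the inner vertices of the three paths are
  \<open>2, \<dots>, p\<close>, then \<open>p + 1, \<dots>, p + q - 1\<close>, then \<open>p + q, \<dots>, p + q + r - 2\<close>.
  Intended for \<open>1 \<le> p \<le> q \<le> r\<close> and \<open>q \<ge> 2\<close>.
\<close>

definition theta :: "nat \<Rightarrow> nat \<Rightarrow> nat \<Rightarrow> nat pair_pre_digraph" where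
  "theta p q r =
    (let E = path_arcs (0 # [2..<p + 1] @ [1])
           \<union> path_arcs (0 # [p + 1..<p + q] @ [1])
           \<union> path_arcs (0 # [p + q..<p + q + r - 1] @ [1])
     in \<lparr>pverts = {..<p + q + r - 1}, parcs = E \<union> E\<inverse>\<rparr>)"

text \<open>\<open>S\<^sub>n\<^sub>,\<^sub>k\<close>, where the vertices below \<open>k\<close> form the complete graph \<open>K\<^sub>k\<close>.\<close>

definition S_graph :: "nat \<Rightarrow> nat \<Rightarrow> nat pair_pre_digraph" where
  "S_graph n k =
    \<lparr>pverts = {..<n},
     parcs = {(i, j). i < n \<and> j < n \<and> i \<noteq> j \<and> (i < k \<or> j < k)}\<rparr>"

text \<open>
  \<open>F\<^sub>m\<^sub>,\<^sub>t\<close>, intended for odd \<open>m - t\<close>, so that the division is exact. The \<open>t\<close> pendant vertices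
  \<open>n, \<dots>, n + t - 1\<close> are attached to vertex 0, which has maximum degree \<open>n - 1\<close> in \<open>S\<^sub>n\<^sub>,\<^sub>2\<close>.
\<close>

definition F_graph :: "nat \<Rightarrow> nat \<Rightarrow> nat pair_pre_digraph" where
  "F_graph m t =
    (let n = (m - t + 3) div 2; P = {n..<n + t}
     in \<lparr>pverts = pverts (S_graph n 2) \<union> P,
         parcs = parcs (S_graph n 2) \<union> {0} \<times> P \<union> P \<times> {0}\<rparr>)"

definition is_largest_root :: "(real \<Rightarrow> real) \<Rightarrow> real \<Rightarrow> bool" where
  "is_largest_root f x \<longleftrightarrow> f x = 0 \<and> (\<forall>y. f y = 0 \<longrightarrow> y \<le> x)"

definition F_quartic :: "nat \<Rightarrow> nat \<Rightarrow> real \<Rightarrow> real" where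
  "F_quartic m t x =
    x ^ 4 - real m * x ^ 2 - (real m - real t - 1) * x + real t / 2 * (real m - real t - 1)"

lemma spectrum_adj_matrix_mono:
  assumes vs: "distinct vs" and ws: "distinct ws" and eq: "set vs = set ws"
  shows "spectrum (adj_matrix G vs) \<subseteq> spectrum (adj_matrix G ws)"
proof
  fix k assume "k \<in> spectrum (adj_matrix G vs)"
  define n where "n = length vs"
  have n': "length ws = n"
    using vs ws eq unfolding n_def by (metis distinct_card)
  from \<open>k \<in> _\<close> obtain v where v: "v \<in> carrier_vec n" "v \<noteq> 0\<^sub>v n"
    and ev: "adj_matrix G vs *\<^sub>v v = k \<cdot>\<^sub>v v"
    by (auto simp: spectrum_def eigenvalue_def eigenvector_def adj_matrix_def n_def)
  have bv: "bij_betw ((!) vs) {..<n} (set ws)"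
    using bij_betw_nth[OF vs] eq n_def by blast
  have bw: "bij_betw ((!) ws) {..<n} (set ws)"
    using bij_betw_nth[OF ws] n' by blast
  define s where "s = the_inv_into {..<n} ((!) vs) \<circ> (!) ws"
  have bs: "bij_betw s {..<n} {..<n}"
    unfolding s_def using bij_betw_trans[OF bw bij_betw_the_inv_into[OF bv]] .
  have s_lt: "s i < n" if "i < n" for i
    using bij_betw_apply[OF bs] that by auto
  have s_nth: "vs ! s i = ws ! i" if "i < n" for i
    using that bv bw unfolding s_def comp_def
    by (metis bij_betw_apply f_the_inv_into_f_bij_betw lessThan_iff)
  define w where "w = vec n (\<lambda>i. v $ s i)"
  have "w \<noteq> 0\<^sub>v n"
  proof
    assume w0: "w = 0\<^sub>v n"
    have "v $ j = 0" if "j < n" for j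
    proof -
      obtain i where i: "i < n" "j = s i"
        using bs \<open>j < n\<close> unfolding bij_betw_def by (metis imageE lessThan_iff)
      then show ?thesis
        using w0 unfolding w_def by (metis index_vec index_zero_vec(1))
    qed
    then have "v = 0\<^sub>v n" using v(1) by (intro eq_vecI) auto
    then show False using v(2) by simp
  qed
  moreover have "adj_matrix G ws *\<^sub>v w = k \<cdot>\<^sub>v w"
  proof (rule eq_vecI)
    fix i assume "i < dim_vec (k \<cdot>\<^sub>v w)"
    then have i: "i < n" by (simp add: w_def)
    let ?a = "\<lambda>x y. if (x, y) \<in> parcs G then 1 else (0 :: complex)"
    have "(adj_matrix G ws *\<^sub>v w) $ i = (\<Sum>j<n. ?a (ws ! i) (ws ! j) * v $ s j)"
      using i n' by (simp add: adj_matrix_def scalar_prod_def w_def lessThan_atLeast0)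
    also have "\<dots> = (\<Sum>j<n. ?a (vs ! s i) (vs ! s j) * v $ s j)"
      using i by (intro sum.cong) (auto simp: s_nth)
    also have "\<dots> = (\<Sum>j<n. ?a (vs ! s i) (vs ! j) * v $ j)"
      by (rule sum.reindex_bij_betw[OF bs, of "\<lambda>j. ?a (vs ! s i) (vs ! j) * v $ j"])
    also have "\<dots> = (adj_matrix G vs *\<^sub>v v) $ s i"
      using s_lt[OF i] v(1) n_def by (simp add: adj_matrix_def scalar_prod_def lessThan_atLeast0)
    also have "\<dots> = (k \<cdot>\<^sub>v w) $ i"
      using i s_lt[OF i] v(1) by (simp add: ev w_def)
    finally show "(adj_matrix G ws *\<^sub>v w) $ i = (k \<cdot>\<^sub>v w) $ i" .
  qed (simp add: adj_matrix_def w_def n')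
  ultimately show "k \<in> spectrum (adj_matrix G ws)"
    unfolding spectrum_def eigenvalue_def eigenvector_def mem_Collect_eq
    using n' by (intro exI[of _ w]) (simp add: adj_matrix_def w_def)
qed

lemma rho_eq:
  assumes "distinct vs" "set vs = pverts G"
  shows "rho G = spectral_radius (adj_matrix G vs)"
proof -
  have "distinct (SOME vs. distinct vs \<and> set vs = pverts G) \<and>
      set (SOME vs. distinct vs \<and> set vs = pverts G) = pverts G"
    using assms by (intro someI[of "\<lambda>vs. distinct vs \<and> set vs = pverts G"]) auto
  then show ?thesis
    using assms unfolding rho_def spectral_radius_def
    by (metis spectrum_adj_matrix_mono subset_antisym)
qed

end

theory Submission
  imports Defs "HOL-Analysis.Function_Topology"
begin

text \<open>
  Let \<open>x\<close> be a nonnegative eigenfunction for \<open>l = \<rho>(G)\<close> with maximum \<open>1\<close>, attained at \<open>z\<close>. Let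
  \<open>U\<close> be the neighbourhood of \<open>z\<close>, let \<open>W\<close> be the set of remaining vertices, and let \<open>d u\<close> be
  the number of neighbours of \<open>u\<close> in \<open>U\<close>. Evaluating \<open>l\<^sup>2 - l\<close> at \<open>z\<close> turns the deficit
  \<open>m - (l\<^sup>2 - l)\<close> into a sum of nonnegative contributions: \<open>1\<close> from each edge inside \<open>W\<close>, \<open>1 - x w\<close>
  from each edge between \<open>U\<close> and \<open>w \<in> W\<close>, \<open>x u\<close> from each \<open>u \<in> U\<close> with \<open>d u = 0\<close>, and
  \<open>1 - (1 - 1 / d a) x a - (1 - 1 / d b) x b\<close> from each edge \<open>ab\<close> inside \<open>U\<close>. The last one is
  nonnegative because \<open>U\<close> contains no path on four vertices. If \<open>l\<close> is at least the largest root of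
  the quartic, the deficit is less than \<open>1 + t / 2 \<le> 2\<close> and \<open>l \<ge> 5\<close>. Since triangles in \<open>U\<close> cost at
  least \<open>2\<close> and stars at least \<open>1\<close>, there is exactly one star in \<open>U\<close>; there is then no room for
  vertices in \<open>W\<close>, so \<open>G\<close> is \<open>F\<^sub>m\<^sub>,\<^sub>s\<close> for some \<open>s\<close>, and comparing quartics forces \<open>s = t\<close>.
  No connectedness is needed, as zero entries of \<open>x\<close> do no harm.
\<close>

section \<open>Eigenfunctions of the spectral radius\<close>

text \<open>The quadratic form attains its maximum on the compact set of nonnegative unit functions.
  Replacing a function by its absolute value does not decrease the form, so the bound extends to all
  \<open>y\<close>.\<close>

lemma rayleigh_maximizer:
  fixes E :: "('a \<times> 'a) set"
  assumes V: "finite V" "V \<noteq> {}" and E: "E \<subseteq> V \<times> V"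
  obtains x :: "'a \<Rightarrow> real" where "\<And>u. 0 \<le> x u" "(\<Sum>u\<in>V. (x u)\<^sup>2) = 1"
    "\<And>y. (\<Sum>(a, b)\<in>E. y a * y b) \<le> (\<Sum>(a, b)\<in>E. x a * x b) * (\<Sum>u\<in>V. (y u)\<^sup>2)"
proof -
  define q :: "('a \<Rightarrow> real) \<Rightarrow> real" where "q y = (\<Sum>(a, b)\<in>E. y a * y b)" for y
  \<comment> \<open>Entries outside \<open>V\<close> are pinned to 0; being a product of compact
    sets over the whole type, \<open>C\<close> is compact by Tychonoff.\<close>
  define C where "C = Pi\<^sub>E UNIV (\<lambda>u. if u \<in> V then {0..1} else {0 :: real})"
  define K where "K = C \<inter> {y. (\<Sum>u\<in>V. (y u)\<^sup>2) = 1}"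
  have cont: "continuous_on UNIV (\<lambda>y :: 'a \<Rightarrow> real. y u)" for u
    by (rule continuous_on_product_coordinates)
  have "compactin (product_topology (\<lambda>_. euclidean) UNIV) C"
    unfolding C_def by (simp add: compactin_PiE)
  then have "compact C" by (simp add: euclidean_product_topology)
  moreover have "closed {y :: 'a \<Rightarrow> real. (\<Sum>u\<in>V. (y u)\<^sup>2) = 1}"
    by (intro closed_Collect_eq continuous_intros cont)
  ultimately have "compact K" unfolding K_def by (rule compact_Int_closed)
  moreover obtain u0 where u0: "u0 \<in> V" using V by blast
  have "(\<lambda>u. if u = u0 then 1 else 0) \<in> K"
    using u0 V(1) by (auto simp: K_def C_def PiE_def Pi_def if_distrib[of "\<lambda>t. t\<^sup>2"] cong: if_cong)
  then have "K \<noteq> {}" by blast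
  moreover have "continuous_on K q"
    unfolding q_def split_beta
    by (intro continuous_intros continuous_on_subset[OF cont]) auto
  ultimately obtain x where x: "x \<in> K" and mx: "\<And>y. y \<in> K \<Longrightarrow> q y \<le> q x"
    using continuous_attains_sup[of K q] by blast
  have "q y \<le> q x * (\<Sum>u\<in>V. (y u)\<^sup>2)" for y
  proof -
    define s where "s = sqrt (\<Sum>u\<in>V. (y u)\<^sup>2)"
    have s2: "s\<^sup>2 = (\<Sum>u\<in>V. (y u)\<^sup>2)" unfolding s_def by (simp add: sum_nonneg)
    show ?thesis
    proof (cases "s = 0")
      case True
      then have "\<forall>u\<in>V. y u = 0" using s2 V(1) by (simp add: sum_nonneg_eq_0_iff)
      then have "q y = 0" using E unfolding q_def by (intro sum.neutral) auto
      then show ?thesis using s2 True by simp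
    next
      case False
      then have s: "s > 0" unfolding s_def by (simp add: sum_nonneg order_less_le)
      \<comment> \<open>The normalised absolute value of \<open>y\<close> lies in \<open>K\<close>
        and can be compared with the maximiser.\<close>
      define z where "z u = (if u \<in> V then \<bar>y u\<bar> / s else 0)" for u
      have z2: "(\<Sum>u\<in>V. (z u)\<^sup>2) = 1"
        using False s2 by (simp add: z_def power_divide flip: sum_divide_distrib s2)
      have "z u \<le> 1" if "u \<in> V" for u
      proof -
        have "(z u)\<^sup>2 \<le> 1" using member_le_sum[OF that, of "\<lambda>u. (z u)\<^sup>2"] V(1) z2 by simp
        then show ?thesis by (simp add: power_le_one_iff z_def abs_square_le_1)
      qed
      then have "z \<in> K" using z2 s by (auto simp: K_def C_def PiE_def Pi_def z_def)
      have "q y \<le> s\<^sup>2 * q z"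
        unfolding q_def sum_distrib_left
      proof (rule sum_mono, clarify)
        fix a b assume "(a, b) \<in> E"
        then have "s\<^sup>2 * (z a * z b) = \<bar>y a * y b\<bar>"
          using E s by (auto simp: z_def power2_eq_square abs_mult)
        then show "y a * y b \<le> s\<^sup>2 * (z a * z b)" by simp
      qed
      also have "\<dots> \<le> s\<^sup>2 * q x" using mx[OF \<open>z \<in> K\<close>] by (intro mult_left_mono) auto
      finally show ?thesis by (simp add: s2 mult.commute)
    qed
  qed
  moreover have "0 \<le> x u" for u
    using x by (cases "u \<in> V") (auto simp: K_def C_def PiE_def Pi_def split: if_splits dest: spec[of _ u])
  ultimately show ?thesis using that x unfolding q_def K_def by auto
qed

text \<open>A parabola in \<open>e\<close> that is nonnegative and vanishes at 0 has slope 0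
  there.\<close>

lemma linear_coeff_zero:
  fixes g c :: real
  assumes "\<And>e. 0 \<le> 2 * e * g + e\<^sup>2 * c"
  shows "g = 0"
proof (rule ccontr)
  assume g: "g \<noteq> 0"
  \<comment> \<open>At \<open>e = - g / k\<close> the expression equals
    \<open>g\<^sup>2 * (c - 2 * k) / k\<^sup>2\<close>, which is negative because
    \<open>2 * k\<close> exceeds \<open>c\<close>.\<close>
  define k where "k = \<bar>c\<bar> + 1"
  have k: "k > 0" "c < 2 * k" unfolding k_def by auto
  have "0 \<le> (2 * (- g / k) * g + (- g / k)\<^sup>2 * c) * k\<^sup>2"
    by (rule mult_nonneg_nonneg[OF assms]) simp
  also have "\<dots> = g\<^sup>2 * (c - 2 * k)"
    using k by (simp add: field_simps power2_eq_square)
  also have "\<dots> < 0" using g k by (intro mult_pos_neg) auto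
  finally show False by simp
qed

text \<open>First variation: a maximiser of the Rayleigh quotient satisfies the eigenvalue equation.
  The Rayleigh bound is kept in the conclusion because it later identifies \<open>l\<close> with the
  spectral radius.\<close>

lemma nonneg_eigenfunction:
  fixes E :: "('a \<times> 'a) set"
  assumes V: "finite V" "V \<noteq> {}" and E: "E \<subseteq> V \<times> V" "sym E"
  obtains x :: "'a \<Rightarrow> real" and l where "\<And>u. 0 \<le> x u" "\<exists>u\<in>V. x u \<noteq> 0"
    "\<And>u. u \<in> V \<Longrightarrow> (\<Sum>v\<in>E `` {u}. x v) = l * x u"
    "\<And>y. (\<Sum>(a, b)\<in>E. y a * y b) \<le> l * (\<Sum>u\<in>V. (y u)\<^sup>2)"
proof -
  obtain x :: "'a \<Rightarrow> real" where x: "\<And>u. 0 \<le> x u" and x2: "(\<Sum>u\<in>V. (x u)\<^sup>2) = 1"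
    and mx: "\<And>y. (\<Sum>(a, b)\<in>E. y a * y b) \<le> (\<Sum>(a, b)\<in>E. x a * x b) * (\<Sum>u\<in>V. (y u)\<^sup>2)"
    using rayleigh_maximizer[OF V E(1)] by blast
  define l where "l = (\<Sum>(a, b)\<in>E. x a * x b)"
  have finE: "finite E" using finite_subset[OF E(1)] V by blast
  have eig: "(\<Sum>v\<in>E `` {u}. x v) = l * x u" if u: "u \<in> V" for u
  proof -
    \<comment> \<open>Perturbing \<open>x\<close> along the indicator of \<open>u\<close> makes the
      eigenvalue equation at \<open>u\<close> the linear coefficient of a nonnegative
      parabola.\<close>
    define h :: "'a \<Rightarrow> real" where "h v = (if v = u then 1 else 0)" for v
    have row: "(\<Sum>(a, b)\<in>E. h a * x b) = (\<Sum>v\<in>E `` {u}. x v)"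
    proof -
      have "(\<Sum>(a, b)\<in>E. h a * x b) = (\<Sum>(a, b)\<in>Pair u ` (E `` {u}). x b)"
        by (rule sum.mono_neutral_cong_right) (auto simp: finE h_def)
      then show ?thesis by (simp add: sum.reindex inj_on_def)
    qed
    have swap: "(\<Sum>(a, b)\<in>E. x a * h b) = (\<Sum>(a, b)\<in>E. h a * x b)"
      by (rule sum.reindex_bij_witness[of _ prod.swap prod.swap])
        (use E(2) in \<open>auto simp: sym_def\<close>)
    have "x v * h v = (if v = u then x v else 0)" "(h v)\<^sup>2 = (if v = u then 1 else 0)" for v
      by (auto simp: h_def)
    then have lin: "(\<Sum>v\<in>V. x v * h v) = x u" "(\<Sum>v\<in>V. (h v)\<^sup>2) = 1"
      using u V(1) by simp_all
    have "0 \<le> 2 * e * (l * x u - (\<Sum>v\<in>E `` {u}. x v)) + e\<^sup>2 * (l - (\<Sum>(a, b)\<in>E. h a * h b))" for e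
    proof -
      have "(\<Sum>(a, b)\<in>E. (x a + e * h a) * (x b + e * h b)) =
          l + e * (\<Sum>(a, b)\<in>E. x a * h b) + e * (\<Sum>(a, b)\<in>E. h a * x b) + e\<^sup>2 * (\<Sum>(a, b)\<in>E. h a * h b)"
        unfolding l_def sum_distrib_left sum.distrib[symmetric]
        by (rule sum.cong) (auto simp: algebra_simps power2_eq_square)
      moreover have "(\<Sum>v\<in>V. (x v + e * h v)\<^sup>2) =
          (\<Sum>v\<in>V. (x v)\<^sup>2) + 2 * e * (\<Sum>v\<in>V. x v * h v) + e\<^sup>2 * (\<Sum>v\<in>V. (h v)\<^sup>2)"
        unfolding sum_distrib_left sum.distrib[symmetric]
        by (rule sum.cong) (auto simp: algebra_simps power2_eq_square)
      ultimately show ?thesis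
        using mx[of "\<lambda>v. x v + e * h v"] unfolding l_def[symmetric] x2 lin swap row
        by (simp add: algebra_simps)
    qed
    then have "l * x u - (\<Sum>v\<in>E `` {u}. x v) = 0" by (rule linear_coeff_zero)
    then show ?thesis by simp
  qed
  have "\<exists>u\<in>V. x u \<noteq> 0"
  proof (rule ccontr)
    assume "\<not> ?thesis"
    then have "(\<Sum>u\<in>V. (x u)\<^sup>2) = 0" by simp
    then show False using x2 by simp
  qed
  show ?thesis
  proof (rule that)
    show "\<exists>u\<in>V. x u \<noteq> 0" by fact
    show "(\<Sum>(a, b)\<in>E. y a * y b) \<le> l * (\<Sum>u\<in>V. (y u)\<^sup>2)" for y unfolding l_def by (rule mx)
  qed (use x eig in auto)
qed

section \<open>Eigenvalues of the adjacency matrix via functions on the vertices\<close>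

lemma eigenvalue_adj_matrix_iff:
  assumes vs: "distinct vs" "set vs = pverts G" and E: "parcs G \<subseteq> pverts G \<times> pverts G"
  shows "k \<in> spectrum (adj_matrix G vs) \<longleftrightarrow>
    (\<exists>y. (\<exists>u\<in>pverts G. y u \<noteq> 0) \<and> (\<forall>u\<in>pverts G. (\<Sum>v\<in>parcs G `` {u}. y v) = k * y u))"
proof -
  define n where "n = length vs"
  have row: "(adj_matrix G vs *\<^sub>v vec n (\<lambda>i. y (vs ! i))) $ i = (\<Sum>v\<in>parcs G `` {vs ! i}. y v)"
    if "i < n" for i and y :: "'a \<Rightarrow> complex"
  proof -
    have "(adj_matrix G vs *\<^sub>v vec n (\<lambda>i. y (vs ! i))) $ i =
        (\<Sum>j<n. (if (vs ! i, vs ! j) \<in> parcs G then 1 else 0) * y (vs ! j))"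
      using that by (simp add: adj_matrix_def scalar_prod_def n_def lessThan_atLeast0)
    also have "\<dots> = (\<Sum>v\<in>pverts G. (if (vs ! i, v) \<in> parcs G then 1 else 0) * y v)"
      using bij_betw_nth[OF vs(1) refl vs(2)[symmetric]] unfolding n_def
      by (rule sum.reindex_bij_betw)
    also have "\<dots> = (\<Sum>v\<in>parcs G `` {vs ! i}. y v)"
      by (rule sum.mono_neutral_cong_right) (use E vs(2)[symmetric] in auto)
    finally show ?thesis .
  qed
  have A: "dim_row (adj_matrix G vs) = n" by (simp add: adj_matrix_def n_def)
  show ?thesis
  proof
    assume "k \<in> spectrum (adj_matrix G vs)"
    then obtain w where w: "w \<in> carrier_vec n" "w \<noteq> 0\<^sub>v n" "adj_matrix G vs *\<^sub>v w = k \<cdot>\<^sub>v w"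
      by (auto simp: spectrum_def eigenvalue_def eigenvector_def A)
    \<comment> \<open>The position of \<open>v\<close> in \<open>vs\<close> is unique because
      \<open>vs\<close> is distinct.\<close>
    define y where "y v = w $ (THE i. i < n \<and> vs ! i = v)" for v
    have y: "y (vs ! i) = w $ i" if "i < n" for i
    proof -
      have "(THE j. j < n \<and> vs ! j = vs ! i) = i"
        using that vs(1) by (intro the_equality) (auto simp: nth_eq_iff_index_eq n_def)
      then show ?thesis by (simp add: y_def)
    qed
    have w': "w = vec n (\<lambda>i. y (vs ! i))" using w(1) y by (intro eq_vecI) auto
    have "\<exists>i<n. w $ i \<noteq> 0" using w(1,2) by (metis carrier_vecD eq_vecI index_zero_vec)
    then have "\<exists>u\<in>pverts G. y u \<noteq> 0" using y vs(2) n_def by (metis nth_mem)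
    moreover have "(\<Sum>v\<in>parcs G `` {u}. y v) = k * y u" if u: "u \<in> pverts G" for u
    proof -
      obtain i where i: "i < n" "u = vs ! i" using u vs(2) n_def by (metis in_set_conv_nth)
      have "(\<Sum>v\<in>parcs G `` {u}. y v) = (adj_matrix G vs *\<^sub>v w) $ i"
        unfolding i(2) row[OF i(1), symmetric] w'[symmetric] ..
      also have "\<dots> = k * w $ i" unfolding w(3) using w(1) i(1) by simp
      finally show ?thesis unfolding i(2) y[OF i(1)] .
    qed
    ultimately show "\<exists>y. (\<exists>u\<in>pverts G. y u \<noteq> 0) \<and>
        (\<forall>u\<in>pverts G. (\<Sum>v\<in>parcs G `` {u}. y v) = k * y u)" by blast
  next
    assume "\<exists>y. (\<exists>u\<in>pverts G. y u \<noteq> 0) \<and> (\<forall>u\<in>pverts G. (\<Sum>v\<in>parcs G `` {u}. y v) = k * y u)"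
    then obtain y u where u: "u \<in> pverts G" "y u \<noteq> 0"
      and ev: "\<And>u. u \<in> pverts G \<Longrightarrow> (\<Sum>v\<in>parcs G `` {u}. y v) = k * y u" by blast
    define w where "w = vec n (\<lambda>i. y (vs ! i))"
    obtain i where i: "i < n" "u = vs ! i" using u vs(2) n_def by (metis in_set_conv_nth)
    then have "w \<noteq> 0\<^sub>v n" using u unfolding w_def by (metis index_vec index_zero_vec(1))
    moreover have "adj_matrix G vs *\<^sub>v w = k \<cdot>\<^sub>v w"
    proof (rule eq_vecI)
      fix i assume "i < dim_vec (k \<cdot>\<^sub>v w)"
      then have "i < n" by (simp add: w_def)
      moreover from this have "vs ! i \<in> pverts G" using vs(2) n_def nth_mem by blast
      ultimately show "(adj_matrix G vs *\<^sub>v w) $ i = (k \<cdot>\<^sub>v w) $ i"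
        using row[of i y] ev by (simp add: w_def)
    qed (simp add: A w_def)
    ultimately show "k \<in> spectrum (adj_matrix G vs)"
      unfolding spectrum_def eigenvalue_def eigenvector_def mem_Collect_eq A
      by (intro exI[of _ w]) (simp add: w_def)
  qed
qed

lemma norm_le_rho:
  assumes V: "finite (pverts G)" "pverts G \<noteq> {}" and E: "parcs G \<subseteq> pverts G \<times> pverts G"
    and y: "\<exists>u\<in>pverts G. y u \<noteq> 0" "\<And>u. u \<in> pverts G \<Longrightarrow> (\<Sum>v\<in>parcs G `` {u}. y v) = k * y u"
  shows "cmod k \<le> rho G"
proof -
  obtain vs where vs: "distinct vs" "set vs = pverts G" using finite_distinct_list[OF V(1)] by blast
  have "k \<in> spectrum (adj_matrix G vs)" by (rule iffD2[OF eigenvalue_adj_matrix_iff[OF vs E]]) (use y in auto)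
  moreover have "length vs > 0" using vs V by auto
  moreover have "adj_matrix G vs \<in> carrier_mat (length vs) (length vs)" by (simp add: adj_matrix_def)
  ultimately show ?thesis
    unfolding rho_eq[OF vs] by (intro spectral_radius_mem_max(2)[of _ "length vs"] imageI)
qed

lemma abs_le_rho:
  fixes y :: "'a \<Rightarrow> real"
  assumes V: "finite (pverts G)" "pverts G \<noteq> {}" and E: "parcs G \<subseteq> pverts G \<times> pverts G"
    and y: "\<exists>u\<in>pverts G. y u \<noteq> 0" "\<And>u. u \<in> pverts G \<Longrightarrow> (\<Sum>v\<in>parcs G `` {u}. y v) = k * y u"
  shows "\<bar>k\<bar> \<le> rho G"
proof -
  have "cmod (complex_of_real k) \<le> rho G"
  proof (rule norm_le_rho[OF V E])
    show "\<exists>u\<in>pverts G. complex_of_real (y u) \<noteq> 0" using y(1) by simp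
    show "(\<Sum>v\<in>parcs G `` {u}. complex_of_real (y v)) = complex_of_real k * complex_of_real (y u)"
      if "u \<in> pverts G" for u
      unfolding of_real_sum[symmetric] of_real_mult[symmetric] y(2)[OF that] ..
  qed
  then show ?thesis by simp
qed

text \<open>The maximum \<open>l\<close> of the Rayleigh quotient is an eigenvalue, so
  \<open>l \<le> rho G\<close>. Conversely, let \<open>y\<close> be a complex eigenfunction whose
  eigenvalue has modulus \<open>rho G\<close>; the triangle inequality at each vertex and the
  Rayleigh bound for the moduli of \<open>y\<close> give \<open>rho G \<le> l\<close>.\<close>

lemma rho_eigenfunction:
  assumes V: "finite (pverts G)" "pverts G \<noteq> {}" and E: "parcs G \<subseteq> pverts G \<times> pverts G" "sym (parcs G)"
  obtains x :: "'a \<Rightarrow> real" where "\<And>u. 0 \<le> x u" "\<exists>u\<in>pverts G. x u \<noteq> 0"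
    "\<And>u. u \<in> pverts G \<Longrightarrow> (\<Sum>v\<in>parcs G `` {u}. x v) = rho G * x u"
proof -
  obtain x :: "'a \<Rightarrow> real" and l where x: "\<And>u. 0 \<le> x u" "\<exists>u\<in>pverts G. x u \<noteq> 0"
    and ev: "\<And>u. u \<in> pverts G \<Longrightarrow> (\<Sum>v\<in>parcs G `` {u}. x v) = l * x u"
    and mx: "\<And>y. (\<Sum>(a, b)\<in>parcs G. y a * y b) \<le> l * (\<Sum>u\<in>pverts G. (y u)\<^sup>2)"
    using nonneg_eigenfunction[OF V E] by blast
  have "l \<le> rho G" using abs_le_rho[OF V E(1) x(2) ev] by simp
  moreover have "rho G \<le> l"
  proof -
    obtain vs where vs: "distinct vs" "set vs = pverts G" using finite_distinct_list[OF V(1)] by blast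
    have "length vs > 0" using vs V by auto
    then have "rho G \<in> cmod ` spectrum (adj_matrix G vs)"
      unfolding rho_eq[OF vs] by (intro spectral_radius_mem_max(1)) (auto simp: adj_matrix_def)
    then obtain k where k: "k \<in> spectrum (adj_matrix G vs)" "rho G = cmod k" by blast
    then obtain y where y: "\<exists>u\<in>pverts G. y u \<noteq> 0"
      "\<And>u. u \<in> pverts G \<Longrightarrow> (\<Sum>v\<in>parcs G `` {u}. y v) = k * y u"
      using iffD1[OF eigenvalue_adj_matrix_iff[OF vs E(1)] k(1)] by (elim exE conjE) auto
    have "rho G * (\<Sum>u\<in>pverts G. (cmod (y u))\<^sup>2) = (\<Sum>u\<in>pverts G. cmod (y u) * cmod (k * y u))"
      unfolding sum_distrib_left k(2) by (simp add: norm_mult power2_eq_square ac_simps)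
    also have "\<dots> \<le> (\<Sum>u\<in>pverts G. cmod (y u) * (\<Sum>v\<in>parcs G `` {u}. cmod (y v)))"
      by (intro sum_mono mult_left_mono) (auto simp flip: y(2) intro: norm_sum)
    also have "\<dots> = (\<Sum>(a, b)\<in>Sigma (pverts G) (\<lambda>u. parcs G `` {u}). cmod (y a) * cmod (y b))"
      unfolding sum_distrib_left
      by (rule sum.Sigma) (use V in \<open>auto intro: finite_subset[OF _ V(1)] dest!: subsetD[OF E(1)]\<close>)
    also have "Sigma (pverts G) (\<lambda>u. parcs G `` {u}) = parcs G" using E(1) by auto
    also have "(\<Sum>(a, b)\<in>parcs G. cmod (y a) * cmod (y b)) \<le> l * (\<Sum>u\<in>pverts G. (cmod (y u))\<^sup>2)"
      by (rule mx)
    finally have "rho G * (\<Sum>u\<in>pverts G. (cmod (y u))\<^sup>2) \<le> l * (\<Sum>u\<in>pverts G. (cmod (y u))\<^sup>2)" .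
    moreover have "(\<Sum>u\<in>pverts G. (cmod (y u))\<^sup>2) > 0"
      using y(1) V(1) by (auto intro!: sum_pos2)
    ultimately show ?thesis by simp
  qed
  ultimately show ?thesis using that[of x] x ev by simp
qed

text \<open>An enumeration of the vertices of \<open>G\<close>, carried along the isomorphism,
  yields literally the same matrix for \<open>H\<close>.\<close>

lemma rho_isomorphic:
  assumes "pair_wf_digraph G" "finite (pverts G)" "isomorphic G H"
  shows "rho G = rho H"
proof -
  obtain f where f: "bij_betw f (pverts G) (pverts H)" "parcs H = (\<lambda>(u, v). (f u, f v)) ` parcs G"
    using iffD1[OF isomorphic_iff[OF assms(1)] assms(3)] by (elim exE conjE)
  interpret pair_wf_digraph G by fact
  obtain vs where vs: "distinct vs" "set vs = pverts G" using finite_distinct_list[OF assms(2)] by blast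
  have ws: "distinct (map f vs)" "set (map f vs) = pverts H"
    using vs f(1) by (auto simp: distinct_map bij_betw_def)
  have "(f u, f v) \<in> parcs H \<longleftrightarrow> (u, v) \<in> parcs G" if uv: "u \<in> pverts G" "v \<in> pverts G" for u v
  proof
    assume "(f u, f v) \<in> parcs H"
    then obtain a b where ab: "(a, b) \<in> parcs G" "f u = f a" "f v = f b" unfolding f(2) by auto
    then have "u = a" "v = b"
      using f(1) uv in_arcsD1[OF ab(1)] in_arcsD2[OF ab(1)] unfolding bij_betw_def inj_on_def by blast+
    then show "(u, v) \<in> parcs G" using ab(1) by simp
  qed (force simp: f(2))
  moreover have "vs ! i \<in> pverts G" if "i < length vs" for i using vs(2) nth_mem[OF that] by simp
  ultimately have "adj_matrix H (map f vs) = adj_matrix G vs"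
    unfolding adj_matrix_def by (intro cong_mat) auto
  then show ?thesis using rho_eq[OF vs] rho_eq[OF ws] by simp
qed

section \<open>The deficit of a theta-free graph\<close>

text \<open>For distinct \<open>z\<close>, \<open>v\<close> and disjoint \<open>L\<close>,
  \<open>P\<close> avoiding them, this is \<open>F_graph m t\<close> up to renaming, with
  \<open>t = card P\<close> and \<open>m = 2 * card L + card P + 1\<close>: two adjacent hubs, their
  common neighbours \<open>L\<close>, and pendant vertices \<open>P\<close> at
  \<open>z\<close>.\<close>

definition fan_arcs :: "'a \<Rightarrow> 'a \<Rightarrow> 'a set \<Rightarrow> 'a set \<Rightarrow> ('a \<times> 'a) set" where
  "fan_arcs z v L P = (let K = {z} \<times> insert v (L \<union> P) \<union> {v} \<times> L in K \<union> K\<inverse>)"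

lemma card_ge_if_subset: "finite B \<Longrightarrow> A \<subseteq> B \<Longrightarrow> card A = n \<Longrightarrow> n \<le> card B"
  using card_mono by blast

text \<open>\<open>theta_free\<close> forbids \<open>theta 1 2 3\<close> with endpoints
  \<open>a\<close> and \<open>b\<close>: the edge \<open>ab\<close>, the path through
  \<open>c\<close>, and the path through \<open>d\<close> and \<open>e\<close>. As \<open>E\<close>
  holds both orientations of every edge, \<open>card E / 2\<close> is the number of edges. The last
  two bounds are what the quartic and \<open>m \<ge> 22\<close> supply.\<close>

locale theta_free_eigen =
  fixes V :: "'a set" and E :: "('a \<times> 'a) set" and x :: "'a \<Rightarrow> real" and l :: real and z :: 'a
  assumes fin: "finite V" and E_sub: "E \<subseteq> V \<times> V"
    and sym: "(a, b) \<in> E \<Longrightarrow> (b, a) \<in> E" and irrefl: "(a, a) \<notin> E"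
    and theta_free: "\<lbrakk>(a, b) \<in> E; (a, c) \<in> E; (c, b) \<in> E; (a, d) \<in> E; (d, e) \<in> E; (e, b) \<in> E;
      distinct [a, b, c, d, e]\<rbrakk> \<Longrightarrow> False"
    and zV: "z \<in> V" and x_z: "x z = 1" and x_nonneg: "0 \<le> x u" and x_le_1: "u \<in> V \<Longrightarrow> x u \<le> 1"
    and eigen: "u \<in> V \<Longrightarrow> (\<Sum>v\<in>E `` {u}. x v) = l * x u"
    and l_ge_5: "5 \<le> l" and deficit_less: "card E / 2 - (l\<^sup>2 - l) < 2"
begin

definition U where "U = E `` {z}"
definition W where "W = V - insert z U"
definition N where "N u = E `` {u} \<inter> U"
definition M where "M u = E `` {u} \<inter> W"
definition d where "d u = card (N u)"
text \<open>\<open>EU\<close> and \<open>Y\<close> contain both orientations of an edge,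
  \<open>X\<close> only the one from \<open>U\<close> to \<open>W\<close>; hence the factors 1/2 in
  the formula for the deficit.\<close>

definition EU where "EU = E \<inter> U \<times> U"
definition X where "X = E \<inter> U \<times> W"
definition Y where "Y = E \<inter> W \<times> W"
definition U0 where "U0 = {u \<in> U. d u = 0}"
definition deficit where "deficit = card E / 2 - (l\<^sup>2 - l)"

text \<open>The share of the deficit carried by an edge inside the neighbourhood \<open>U\<close> of \<open>z\<close>.\<close>

definition q where "q a b = 1 - (1 - 1 / d a) * x a - (1 - 1 / d b) * x b"

section \<open>Splitting the arcs along z, U and W, and the deficit formula\<close>

lemma in_V: "(a, b) \<in> E \<Longrightarrow> a \<in> V" "(a, b) \<in> E \<Longrightarrow> b \<in> V"
  using E_sub by auto

lemma sym_iff: "(a, b) \<in> E \<longleftrightarrow> (b, a) \<in> E" using sym by blast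

lemma U_sub: "U \<subseteq> V" using E_sub by (auto simp: U_def)
lemma W_sub: "W \<subseteq> V" by (auto simp: W_def)
lemma z_notin: "z \<notin> U" "z \<notin> W" using irrefl by (auto simp: U_def W_def)
lemma UW_disj: "U \<inter> W = {}" by (auto simp: W_def)
lemma V_eq: "V = insert z (U \<union> W)" using U_sub zV by (auto simp: W_def)
lemma zU: "u \<in> U \<longleftrightarrow> (z, u) \<in> E" "u \<in> U \<longleftrightarrow> (u, z) \<in> E" by (auto simp: U_def sym)
lemma zW: "w \<in> W \<Longrightarrow> (z, w) \<notin> E" "w \<in> W \<Longrightarrow> (w, z) \<notin> E" by (auto simp: W_def zU[symmetric])

lemma finE: "finite E" using finite_subset[OF E_sub] fin by simp
lemma finU: "finite U" using finite_subset[OF U_sub] fin by simp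
lemma finW: "finite W" using finite_subset[OF W_sub] fin by simp
lemma finN: "finite (N u)" "finite (M u)" using finU finW by (auto simp: N_def M_def)
lemma finX: "finite EU" "finite X" "finite Y" using finE by (auto simp: EU_def X_def Y_def)
lemma finU0: "finite U0" using finU by (simp add: U0_def)

lemma EU_iff: "(a, b) \<in> EU \<longleftrightarrow> a \<in> U \<and> b \<in> N a" by (auto simp: EU_def N_def)
lemma EU_sym: "(a, b) \<in> EU \<Longrightarrow> (b, a) \<in> EU" using sym by (auto simp: EU_def)
lemma EU_neq: "(a, b) \<in> EU \<Longrightarrow> a \<noteq> b" using irrefl by (auto simp: EU_def)
lemma EU_d: "(a, b) \<in> EU \<Longrightarrow> d a \<ge> 1" using finN by (auto simp: EU_iff d_def Suc_le_eq card_gt_0_iff)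
lemma EU_Sigma: "Sigma U N = EU" by (auto simp: EU_iff)
lemma X_Sigma: "Sigma U M = X" by (auto simp: X_def M_def)

lemma nbrs_U:
  assumes "u \<in> U" shows "E `` {u} = insert z (N u \<union> M u)"
  using assms in_V V_eq by (auto simp: N_def M_def zU(2)[symmetric])

lemma eigen_U:
  assumes u: "u \<in> U"
  shows "l * x u = 1 + (\<Sum>v\<in>N u. x v) + (\<Sum>w\<in>M u. x w)"
proof -
  have "l * x u = (\<Sum>v\<in>E `` {u}. x v)" using eigen U_sub u by auto
  also have "\<dots> = x z + (\<Sum>v\<in>N u \<union> M u. x v)"
    unfolding nbrs_U[OF u] using z_notin finN by (intro sum.insert) (auto simp: N_def M_def)
  also have "(\<Sum>v\<in>N u \<union> M u. x v) = (\<Sum>v\<in>N u. x v) + (\<Sum>w\<in>M u. x w)"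
    using finN UW_disj by (intro sum.union_disjoint) (auto simp: N_def M_def)
  finally show ?thesis by (simp add: x_z)
qed

lemma sum_U: "(\<Sum>u\<in>U. x u) = l"
  using eigen[OF zV] by (simp add: U_def x_z)

lemma sum_X: "(\<Sum>(u, w)\<in>X. f u w) = (\<Sum>u\<in>U. \<Sum>w\<in>M u. f u w)"
  unfolding X_Sigma[symmetric] using finU finN by (simp add: sum.Sigma)

lemma sum_EU: "(\<Sum>(a, b)\<in>EU. f a b) = (\<Sum>a\<in>U. \<Sum>b\<in>N a. f a b)"
  unfolding EU_Sigma[symmetric] using finU finN by (simp add: sum.Sigma)

lemma sum_EU_swap: "(\<Sum>(a, b)\<in>EU. f b a) = (\<Sum>(a, b)\<in>EU. f a b)"
  by (rule sum.reindex_bij_witness[of _ prod.swap prod.swap]) (auto intro: EU_sym)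

text \<open>The disjoint union is nested to the right so that the cardinality can be computed by
  splitting off one block at a time.\<close>

lemma E_eq: "E = {z} \<times> U \<union> (U \<times> {z} \<union> (EU \<union> (X \<union> (X\<inverse> \<union> Y))))"
proof (intro subset_antisym subrelI)
  fix a b assume ab: "(a, b) \<in> E"
  then have "a = z \<or> a \<in> U \<or> a \<in> W" "b = z \<or> b \<in> U \<or> b \<in> W" "(b, a) \<in> E"
    using in_V V_eq sym_iff[of a b] by auto
  then show "(a, b) \<in> {z} \<times> U \<union> (U \<times> {z} \<union> (EU \<union> (X \<union> (X\<inverse> \<union> Y))))"
    using ab zU[of a] zU[of b] zW[of a] zW[of b] irrefl by (auto simp: EU_def X_def Y_def)
qed (auto simp: EU_def X_def Y_def zU sym)

lemma card_E: "card E = 2 * card U + card EU + 2 * card X + card Y"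
proof -
  let ?A = "{z} \<times> U" and ?B = "U \<times> {z}"
  have fin: "finite ?A" "finite ?B" "finite EU" "finite X" "finite (X\<inverse>)" "finite Y"
    using finX finU by auto
  have "?A \<inter> (?B \<union> (EU \<union> (X \<union> (X\<inverse> \<union> Y)))) = {}" "?B \<inter> (EU \<union> (X \<union> (X\<inverse> \<union> Y))) = {}"
    "EU \<inter> (X \<union> (X\<inverse> \<union> Y)) = {}" "X \<inter> (X\<inverse> \<union> Y) = {}" "X\<inverse> \<inter> Y = {}"
    using z_notin UW_disj by (auto simp: EU_def X_def Y_def)
  then have "card (?A \<union> (?B \<union> (EU \<union> (X \<union> (X\<inverse> \<union> Y))))) =
      card ?A + (card ?B + (card EU + (card X + (card (X\<inverse>) + card Y))))"
    by (metis (no_types, lifting) card_Un_disjoint finite_UnI fin)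
  then show ?thesis unfolding arg_cong[OF E_eq, of card] by (simp add: card_cartesian_product)
qed

text \<open>Since the entries on \<open>U\<close> sum to \<open>l\<close>, the square of
  \<open>l\<close> is the sum of \<open>l * x u\<close> over \<open>U\<close>, which the eigenvalue
  equations expand. The remaining \<open>l\<close> is distributed over the arcs inside
  \<open>U\<close>.\<close>

lemma deficit_eq:
  "deficit = card Y / 2 + (\<Sum>(u, w)\<in>X. 1 - x w) + (\<Sum>u\<in>U0. x u) + (\<Sum>(a, b)\<in>EU. q a b) / 2"
proof -
  define S where "S = (\<Sum>(a, b)\<in>EU. x a)"
  \<comment> \<open>Spreading \<open>x a\<close> evenly over the \<open>d a\<close> arcs that leave
    \<open>a\<close> recovers the sum over \<open>U\<close>, except for the vertices of
    \<open>U0\<close>; this is the source of the coefficients \<open>1 - 1 / d a\<close> in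
    \<open>q\<close>.\<close>
  define R where "R = (\<Sum>(a, b)\<in>EU. x a / d a)"
  have "l\<^sup>2 = (\<Sum>u\<in>U. l * x u)"
    unfolding sum_distrib_left[symmetric] sum_U by (simp add: power2_eq_square)
  also have "\<dots> = (\<Sum>u\<in>U. 1 + (\<Sum>v\<in>N u. x v) + (\<Sum>w\<in>M u. x w))"
    using eigen_U by (intro sum.cong) auto
  also have "\<dots> = card U + S + (\<Sum>(u, w)\<in>X. x w)"
    using sum_EU_swap[of "\<lambda>a b. x a"]
    unfolding sum.distrib sum_X S_def by (simp add: sum_EU)
  finally have l2: "l\<^sup>2 = card U + S + (\<Sum>(u, w)\<in>X. x w)" .
  have "R = (\<Sum>u\<in>U. if d u = 0 then 0 else x u)"
    unfolding R_def sum_EU by (rule sum.cong) (auto simp: d_def)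
  also have "\<dots> = (\<Sum>u\<in>U. x u) - (\<Sum>u\<in>U0. x u)"
  proof -
    have "(\<Sum>u\<in>U0. x u) = (\<Sum>u\<in>U. if d u = 0 then x u else 0)"
      unfolding U0_def using finU by (intro sum.inter_filter)
    then show ?thesis by (simp flip: sum_subtractf) (rule sum.cong, auto)
  qed
  finally have R: "R = l - (\<Sum>u\<in>U0. x u)" by (simp add: sum_U)
  have "(\<Sum>(a, b)\<in>EU. q a b) = card EU - (\<Sum>(a, b)\<in>EU. (1 - 1 / d a) * x a) - (\<Sum>(a, b)\<in>EU. (1 - 1 / d b) * x b)"
    unfolding q_def split_beta by (simp add: sum_subtractf)
  also have "(\<Sum>(a, b)\<in>EU. (1 - 1 / d b) * x b) = (\<Sum>(a, b)\<in>EU. (1 - 1 / d a) * x a)"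
    by (rule sum_EU_swap)
  also have "\<dots> = S - R"
    unfolding S_def R_def split_beta by (simp add: sum_subtractf algebra_simps)
  finally have "(\<Sum>(a, b)\<in>EU. q a b) = card EU - 2 * (S - R)" by simp
  moreover have "(\<Sum>(u, w)\<in>X. 1 - x w) = card X - (\<Sum>(u, w)\<in>X. x w)"
    unfolding split_beta by (simp add: sum_subtractf)
  ultimately show ?thesis
    unfolding deficit_def card_E l2 using R by (simp add: field_simps)
qed

section \<open>Local structure forced by theta-freeness\<close>

lemma no_path4:
  assumes "a \<in> U" "b \<in> U" "c \<in> U" "e \<in> U" "(a, b) \<in> E" "(b, c) \<in> E" "(c, e) \<in> E" "distinct [a, b, c, e]"
  shows False
  \<comment> \<open>All four vertices are adjacent to \<open>z\<close>, so \<open>z\<close> and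
    \<open>b\<close> are joined by an edge, by the path through \<open>a\<close>, and by the path
    through \<open>e\<close> and \<open>c\<close>.\<close>
  using theta_free[of z b a e c] assms z_notin by (auto simp: zU(1) sym_iff)

text \<open>If \<open>y\<close> differed from \<open>b\<close>, then \<open>z\<close> and
  \<open>a\<close> would be joined by an edge, by the path through \<open>b\<close>, and by the path
  through \<open>y\<close> and \<open>w\<close>.\<close>

lemma W_nbr:
  assumes "w \<in> W" "(a, b) \<in> EU" "(w, a) \<in> E" "(w, y) \<in> E" "y \<in> U" "y \<noteq> a"
  shows "y = b"
proof (rule ccontr)
  assume "y \<noteq> b"
  have ab: "a \<in> U" "b \<in> U" "(b, a) \<in> E" using assms(2) by (auto simp: EU_def sym)
  have "(z, a) \<in> E" "(z, b) \<in> E" "(z, y) \<in> E" using ab assms(5) by (simp_all flip: zU(1))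
  moreover have "distinct [z, a, b, y, w]"
    using ab assms z_notin UW_disj EU_neq[OF assms(2)] \<open>y \<noteq> b\<close> by auto
  ultimately show False
    using theta_free[of z a b y w] ab(3) sym[OF assms(4)] assms(3) by blast
qed

text \<open>Components with edges but no path on four vertices are stars or triangles; this is the
  version for a single edge. If both ends have a further neighbour in \<open>U\<close>, these
  neighbours must coincide, which gives a triangle.\<close>

lemma EU_cases:
  assumes ab: "(a, b) \<in> EU"
  obtains "d a = 1" | "d b = 1" | c where "c \<in> U" "(a, c) \<in> E" "(b, c) \<in> E" "d a = 2" "d b = 2"
proof (cases "d a = 1 \<or> d b = 1")
  case False
  have third: "\<exists>c\<in>N u. c \<noteq> v" if "(u, v) \<in> EU" "d u \<noteq> 1" for u v
  proof (rule ccontr)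
    assume "\<not> ?thesis"
    then have "N u = {v}" using that(1) by (auto simp: EU_iff)
    then show False using that(2) by (simp add: d_def)
  qed
  obtain c where c: "c \<in> N a" "c \<noteq> b" using third[OF ab] False by blast
  obtain e where e: "e \<in> N b" "e \<noteq> a" using third[OF EU_sym[OF ab]] False by blast
  have "c' = e'" if "c' \<in> N a" "c' \<noteq> b" "e' \<in> N b" "e' \<noteq> a" for c' e'
    using no_path4[of c' a b e'] that ab irrefl by (auto simp: EU_def N_def sym_iff)
  then have "N a = {b, c}" "N b = {a, c}" "e = c"
    using c e ab EU_sym[OF ab] by (auto simp: EU_iff)
  moreover have "b \<noteq> c" "a \<noteq> c" using c e \<open>e = c\<close> by auto
  ultimately show ?thesis
    using that(3)[of c] c e by (auto simp: N_def d_def)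
qed (use that in blast)

text \<open>An end of degree 1 has coefficient 0, and in a triangle both coefficients are
  1/2.\<close>

lemma q_nonneg:
  assumes ab: "(a, b) \<in> EU" shows "0 \<le> q a b"
proof -
  have x: "0 \<le> x a" "x a \<le> 1" "0 \<le> x b" "x b \<le> 1"
    using ab x_nonneg x_le_1 U_sub by (auto simp: EU_def)
  have le: "(1 - 1 / d u) * x u \<le> 1" if "x u \<le> 1" "0 \<le> x u" for u
    using mult_mono[of "1 - 1 / d u" 1 "x u" 1] that by simp
  show ?thesis
    using ab by (cases rule: EU_cases) (use x le[of a] le[of b] in \<open>auto simp: q_def\<close>)
qed

text \<open>All summands of \<open>deficit_eq\<close> are nonnegative; \<open>A\<close> and
  \<open>B\<close> select the arcs whose share is kept.\<close>

lemma deficit_ge: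
  assumes "A \<subseteq> EU" "B \<subseteq> X"
  shows "card Y / 2 + (\<Sum>(u, w)\<in>B. 1 - x w) + (\<Sum>u\<in>U0. x u) + (\<Sum>(a, b)\<in>A. q a b) / 2 \<le> deficit"
proof -
  have "(\<Sum>(u, w)\<in>B. 1 - x w) \<le> (\<Sum>(u, w)\<in>X. 1 - x w)"
    using assms finX x_le_1 W_sub by (intro sum_mono2) (auto simp: X_def)
  moreover have "(\<Sum>(a, b)\<in>A. q a b) \<le> (\<Sum>(a, b)\<in>EU. q a b)"
    using assms finX q_nonneg by (intro sum_mono2) auto
  ultimately show ?thesis by (simp add: deficit_eq)
qed

lemma deficit_less_2: "deficit < 2" using deficit_less by (simp add: deficit_def)

lemma sum_U0_nonneg: "0 \<le> (\<Sum>u\<in>U0. x u)" by (intro sum_nonneg x_nonneg)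

text \<open>Two edges inside \<open>W\<close> give four arcs of \<open>Y\<close> and already cost
  2.\<close>

lemma card_M_W:
  assumes w: "w \<in> W" shows "card (M w) \<le> 1"
proof (rule ccontr)
  assume "\<not> ?thesis"
  then obtain a b where ab: "a \<in> M w" "b \<in> M w" "a \<noteq> b"
    using card_le_Suc0_iff_eq[OF finN(2)] by (metis One_nat_def)
  then have "{(w, a), (w, b), (a, w), (b, w)} \<subseteq> Y"
    using w by (auto simp: M_def Y_def sym_iff)
  moreover have "a \<noteq> w" "b \<noteq> w" using ab irrefl by (auto simp: M_def)
  moreover from this have "card {(w, a), (w, b), (a, w), (b, w)} = 4" using ab(3) by simp
  ultimately have "4 \<le> card Y" by (intro card_ge_if_subset[OF finX(3)])
  moreover have "card Y / 2 \<le> deficit" using deficit_ge[of "{}" "{}"] sum_U0_nonneg by simp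
  ultimately show False using deficit_less_2 by simp
qed

text \<open>A triangle in \<open>U\<close> with \<open>p\<close> arcs to \<open>W\<close> contributes at least \<open>2\<close> to the deficit: the entries
  at the \<open>W\<close>-ends of these arcs are at most \<open>2/5\<close>, and those on the triangle sum to at most
  \<open>1 + 2p/15\<close>.\<close>

lemma no_triangle:
  assumes U: "a \<in> U" "b \<in> U" "c \<in> U" and E: "(a, b) \<in> E" "(b, c) \<in> E" "(a, c) \<in> E"
  shows False
proof -
  have neq: "a \<noteq> b" "b \<noteq> c" "a \<noteq> c" using E irrefl by auto
  have N: "N u = {v, t}" if "u \<in> U" "v \<in> U" "t \<in> U" "(u, v) \<in> E" "(u, t) \<in> E" "(v, t) \<in> E" for u v t
  proof -
    have "y = v \<or> y = t" if "y \<in> N u" for y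
      using no_path4[of y u v t] that \<open>u \<in> U\<close> \<open>v \<in> U\<close> \<open>t \<in> U\<close> \<open>(u, v) \<in> E\<close> \<open>(u, t) \<in> E\<close> \<open>(v, t) \<in> E\<close>
        irrefl by (auto simp: N_def sym_iff)
    then show ?thesis using that by (auto simp: N_def)
  qed
  have Na: "N a = {b, c}" and Nb: "N b = {a, c}" and Nc: "N c = {a, b}"
    using N[of a b c] N[of b a c] N[of c a b] U E by (auto simp: sym_iff)
  have M: "(\<Sum>w\<in>M u. x w) \<le> 2 / 5 * card (M u)"
    if u: "u \<in> U" "v \<in> U" "t \<in> U" "(u, v) \<in> E" "(u, t) \<in> E" "v \<noteq> t" for u v t
  proof -
    \<comment> \<open>Applying \<open>W_nbr\<close> to both triangle edges at \<open>u\<close> shows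
      that \<open>u\<close> is the only neighbour of \<open>w\<close> in \<open>U\<close>. At most
      one more neighbour lies in \<open>W\<close>, so \<open>l * x w \<le> 2\<close>.\<close>
    have "x w \<le> 2 / 5" if w: "w \<in> M u" for w
    proof -
      have wW: "w \<in> W" and wu: "(w, u) \<in> E" using w by (auto simp: M_def sym_iff)
      have "y = u" if y: "(w, y) \<in> E" "y \<in> U" for y
        using W_nbr[OF wW _ wu y, of v] W_nbr[OF wW _ wu y, of t] u by (auto simp: EU_def)
      moreover have "y = z \<or> y \<in> U \<or> y \<in> W" if "(w, y) \<in> E" for y
        using in_V(2)[OF that] V_eq by auto
      ultimately have sub: "E `` {w} \<subseteq> insert u (M w)"
        using zW[OF wW] by (fastforce simp: M_def)
      have fin: "finite (insert u (M w))" using finN by simp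
      have "l * x w = (\<Sum>v\<in>E `` {w}. x v)" using eigen W_sub wW by auto
      also have "\<dots> \<le> (\<Sum>v\<in>E `` {w}. 1)" using x_le_1 in_V by (intro sum_mono) auto
      also have "\<dots> = card (E `` {w})" by simp
      also have "\<dots> \<le> 2"
        using card_mono[OF fin sub] card_insert_le_m1[of 2 "M w" u] card_M_W[OF wW] by simp
      finally have "l * x w \<le> 2" by simp
      moreover have "5 * x w \<le> l * x w" using l_ge_5 x_nonneg by (intro mult_right_mono) auto
      ultimately show ?thesis by simp
    qed
    then have "(\<Sum>w\<in>M u. x w) \<le> (\<Sum>w\<in>M u. 2 / 5)" by (intro sum_mono)
    then show ?thesis by simp
  qed
  define P where "P = (\<Sum>w\<in>M a. x w) + (\<Sum>w\<in>M b. x w) + (\<Sum>w\<in>M c. x w)"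
  define p where "p = real (card (M a) + card (M b) + card (M c))"
  have P: "P \<le> 2 / 5 * p"
    using M[of a b c] M[of b a c] M[of c a b] U E neq by (simp add: P_def p_def field_simps sym_iff)
  define S where "S = x a + x b + x c"
  \<comment> \<open>Sum of the eigenvalue equations at the three corners; each corner is a neighbour
    of the other two.\<close>
  have "l * S = 3 + 2 * S + P"
    using eigen_U[OF U(1)] eigen_U[OF U(2)] eigen_U[OF U(3)] neq
    unfolding Na Nb Nc S_def P_def by (simp add: algebra_simps)
  moreover have "5 * S \<le> l * S" using l_ge_5 x_nonneg unfolding S_def by (intro mult_right_mono) auto
  ultimately have S: "3 * S \<le> 3 + P" by simp
  have "{(a, b), (a, c), (b, c), (b, a), (c, a), (c, b)} \<subseteq> EU"
    using U E by (auto simp: EU_def sym_iff)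
  moreover have "(SIGMA u:{a, b, c}. M u) \<subseteq> X" using U by (auto simp: X_Sigma[symmetric])
  ultimately have "(\<Sum>(u, w)\<in>(SIGMA u:{a, b, c}. M u). 1 - x w) +
      (\<Sum>(a, b)\<in>{(a, b), (a, c), (b, c), (b, a), (c, a), (c, b)}. q a b) / 2 \<le> deficit"
    using deficit_ge[of "{(a, b), (a, c), (b, c), (b, a), (c, a), (c, b)}" "SIGMA u:{a, b, c}. M u"]
      sum_U0_nonneg by linarith
  moreover have "(\<Sum>(a, b)\<in>{(a, b), (a, c), (b, c), (b, a), (c, a), (c, b)}. q a b) = 6 - 2 * S"
    using neq by (simp add: q_def d_def Na Nb Nc S_def field_simps)
  moreover have "(\<Sum>(u, w)\<in>(SIGMA u:{a, b, c}. M u). 1 - x w) = (\<Sum>u\<in>{a, b, c}. \<Sum>w\<in>M u. 1 - x w)"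
    using finN by (simp add: sum.Sigma)
  moreover have "\<dots> = p - P" using neq by (simp add: sum_subtractf p_def P_def)
  moreover have "0 \<le> p" by (simp add: p_def)
  \<comment> \<open>The cost is at least \<open>(3 - S) + (p - P)\<close>, hence at least
    \<open>2 + p - 4 / 3 * P\<close>, hence at least \<open>2 + 7 / 15 * p\<close>.\<close>
  ultimately show False using P S deficit_less_2 by linarith
qed

section \<open>Reduction to a single star\<close>

definition center where "center v \<longleftrightarrow> v \<in> U \<and> 1 \<le> d v \<and> (\<forall>b\<in>N v. d b = 1)"
definition star where "star v = {v} \<times> N v \<union> N v \<times> {v}"

lemma star_sub: "v \<in> U \<Longrightarrow> star v \<subseteq> EU"
proof -
  assume "v \<in> U"
  then have "(v, b) \<in> EU" if "b \<in> N v" for b using that by (simp add: EU_iff)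
  then show ?thesis using EU_sym[of v] by (auto simp: star_def)
qed

text \<open>The leaves drop out of \<open>q\<close>, so each of the \<open>d v\<close> edges weighs
  \<open>1 - (1 - 1 / d v) * x v\<close>.\<close>

lemma sum_star:
  assumes v: "center v"
  shows "(\<Sum>(a, b)\<in>star v. q a b) / 2 = 1 + (d v - 1) * (1 - x v)"
proof -
  have "v \<notin> N v" using irrefl by (auto simp: N_def)
  then have disj: "({v} \<times> N v) \<inter> (N v \<times> {v}) = {}" by auto
  have qv: "q v b = 1 - (1 - 1 / d v) * x v" "q b v = 1 - (1 - 1 / d v) * x v" if "b \<in> N v" for b
    using v that by (auto simp: center_def q_def)
  have "(\<Sum>(a, b)\<in>star v. q a b) =
      (\<Sum>e\<in>{v} \<times> N v. 1 - (1 - 1 / d v) * x v) + (\<Sum>e\<in>N v \<times> {v}. 1 - (1 - 1 / d v) * x v)"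
    unfolding star_def
  proof (subst sum.union_disjoint[OF _ _ disj])
    show "(\<Sum>(a, b)\<in>{v} \<times> N v. q a b) + (\<Sum>(a, b)\<in>N v \<times> {v}. q a b) =
      (\<Sum>e\<in>{v} \<times> N v. 1 - (1 - 1 / d v) * x v) + (\<Sum>e\<in>N v \<times> {v}. 1 - (1 - 1 / d v) * x v)"
      by (intro arg_cong2[of _ _ _ _ "(+)"] sum.cong refl) (auto simp: qv)
  qed (use finN in auto)
  also have "\<dots> = 2 * (d v * (1 - (1 - 1 / d v) * x v))"
    by (simp add: card_cartesian_product flip: d_def)
  finally show ?thesis using v by (simp add: center_def field_simps of_nat_diff)
qed

text \<open>With triangles excluded, every edge inside \<open>U\<close> has an end of degree 1, and
  the opposite end is a center. For an isolated edge both ends are centers.\<close>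

lemma center_of_edge:
  assumes ab: "(a, b) \<in> EU" obtains v u where "{u, v} = {a, b}" "(v, u) \<in> EU" "center v"
proof -
  have leaf: "d s = 1 \<or> d t = 1" if "(s, t) \<in> EU" for s t
    using that
  proof (cases rule: EU_cases)
    case (3 c)
    then show ?thesis using no_triangle[of s t c] that by (simp add: EU_def)
  qed auto
  have *: "center s" if st: "(s, t) \<in> EU" "d t = 1" for s t
  proof -
    have "d b = 1" if b: "b \<in> N s" for b
    proof (cases "d s = 1")
      case True
      then obtain y where "N s = {y}" by (auto simp: d_def card_1_singleton_iff)
      then show ?thesis using b st by (auto simp: EU_iff)
    next
      case False
      then show ?thesis using leaf[of s b] b st by (auto simp: EU_iff)
    qed
    then show ?thesis using st EU_d by (auto simp: center_def EU_iff)
  qed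
  show ?thesis
    using leaf[OF ab]
  proof
    assume "d a = 1"
    then show ?thesis using EU_sym[OF ab] * by (intro that[of a b]) auto
  next
    assume "d b = 1"
    then show ?thesis using ab * by (intro that[of b a]) auto
  qed
qed

text \<open>If \<open>U\<close> spans no edge, then \<open>U0 = U\<close> and the deficit is at
  least \<open>l\<close>; two disjoint stars would cost at least 2.\<close>

lemma single_star:
  obtains v where "center v" "EU = star v"
proof -
  have "EU \<noteq> {}"
  proof
    assume "EU = {}"
    then have "N u = {}" if "u \<in> U" for u using that by (auto simp: EU_Sigma[symmetric] Sigma_empty_iff)
    then have "U0 = U" by (auto simp: U0_def d_def)
    then show False using deficit_ge[of "{}" "{}"] sum_U l_ge_5 deficit_less_2 by simp
  qed
  then obtain a0 b0 where "(a0, b0) \<in> EU" by auto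
  then obtain v where v: "center v" using center_of_edge by metis
  have ge1: "1 \<le> (\<Sum>(a, b)\<in>star u. q a b) / 2" if "center u" for u
  proof -
    have "x u \<le> 1" using that x_le_1 U_sub by (auto simp: center_def)
    then have "0 \<le> real (d u - 1) * (1 - x u)" by (intro mult_nonneg_nonneg) auto
    then show ?thesis unfolding sum_star[OF that] by simp
  qed
  have "(a, b) \<in> star v" if ab: "(a, b) \<in> EU" for a b
  proof (rule ccontr)
    assume "(a, b) \<notin> star v"
    moreover have "b \<in> N a" "a \<in> N b" using ab EU_sym[OF ab] by (auto simp: EU_iff)
    ultimately have av: "a \<noteq> v" "b \<noteq> v" by (auto simp: star_def)
    obtain c u where c: "{u, c} = {a, b}" "(c, u) \<in> EU" "center c" by (rule center_of_edge[OF ab])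
    have cu: "c \<noteq> v" "u \<noteq> v" using c(1) av by (auto simp: doubleton_eq_iff)
    have "c \<notin> N v"
    proof
      assume "c \<in> N v"
      then have "(v, c) \<in> EU" and dc: "d c = 1" using v by (auto simp: center_def EU_iff)
      then have "v \<in> N c" "u \<in> N c" using EU_sym[of v c] c(2) by (auto simp: EU_iff)
      moreover obtain y where "N c = {y}" using dc by (auto simp: d_def card_1_singleton_iff)
      ultimately show False using cu by simp
    qed
    then have disj: "star v \<inter> star c = {}" using cu by (auto simp: star_def)
    have "star v \<union> star c \<subseteq> EU" using star_sub[of v] star_sub[of c] v c(3) by (simp add: center_def)
    then have "(\<Sum>(a, b)\<in>star v \<union> star c. q a b) / 2 \<le> deficit"
      using deficit_ge[of "star v \<union> star c" "{}"] sum_U0_nonneg by simp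
    moreover have "finite (star u)" for u using finN by (simp add: star_def)
    then have "(\<Sum>(a, b)\<in>star v \<union> star c. q a b) = (\<Sum>(a, b)\<in>star v. q a b) + (\<Sum>(a, b)\<in>star c. q a b)"
      using disj by (intro sum.union_disjoint)
    ultimately show False using ge1[OF v] ge1[OF c(3)] deficit_less_2 by simp
  qed
  then have "EU = star v" using star_sub[of v] v by (auto simp: center_def)
  then show ?thesis using v by (intro that)
qed


text \<open>An edge inside \<open>W\<close> would add 1 to the cost of the star. If the star had
  only one leaf, the entries on \<open>U0\<close> would sum to at least \<open>l - 2\<close>, which
  is at least 3.\<close>

lemma star_structure:
  obtains v where "center v" "EU = star v" "2 \<le> d v" "Y = {}" "U = insert v (N v \<union> U0)"
    "deficit = 1 + (real (d v) - 1) * (1 - x v) + (\<Sum>u\<in>U0. x u) + (\<Sum>(u, w)\<in>X. 1 - x w)"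
proof -
  obtain v where v: "center v" and EU: "EU = star v" by (rule single_star)
  have vU: "v \<in> U" "1 \<le> d v" using v by (auto simp: center_def)
  have D: "deficit = card Y / 2 + (\<Sum>(u, w)\<in>X. 1 - x w) + (\<Sum>u\<in>U0. x u) + (1 + (real (d v) - 1) * (1 - x v))"
    using deficit_eq sum_star[OF v] EU vU by (simp add: of_nat_diff)
  have nonneg: "0 \<le> (real (d v) - 1) * (1 - x v)" "0 \<le> (\<Sum>(u, w)\<in>X. 1 - x w)"
    using vU x_le_1 U_sub W_sub by (auto intro!: mult_nonneg_nonneg sum_nonneg simp: X_def)
  have Y: "Y = {}"
  proof (rule ccontr)
    assume "Y \<noteq> {}"
    then obtain a b where ab: "(a, b) \<in> Y" by auto
    then have "{(a, b), (b, a)} \<subseteq> Y" "a \<noteq> b" using irrefl by (auto simp: Y_def sym_iff)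
    moreover from this have "card {(a, b), (b, a)} = 2" by simp
    ultimately have "2 \<le> card Y" by (intro card_ge_if_subset[OF finX(3)])
    then show False using D nonneg sum_U0_nonneg deficit_less_2 by simp
  qed
  have "u = v \<or> u \<in> N v \<or> u \<in> U0" if u: "u \<in> U" for u
  proof (cases "d u = 0")
    case False
    then have "N u \<noteq> {}" by (auto simp: d_def)
    then obtain b where "b \<in> N u" by blast
    then have "(u, b) \<in> EU" using u by (simp add: EU_iff)
    then have "(u, b) \<in> star v" using EU by simp
    then show ?thesis by (auto simp: star_def)
  qed (use u in \<open>simp add: U0_def\<close>)
  then have U: "U = insert v (N v \<union> U0)" using vU by (auto simp: N_def U0_def)
  have "d v \<noteq> 1"
  proof
    assume "d v = 1"
    then obtain b where b: "N v = {b}" by (auto simp: d_def card_1_singleton_iff)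
    then have "b \<in> U" by (auto simp: N_def)
    have "l = (\<Sum>u\<in>insert v (N v \<union> U0). x u)" using sum_U U by simp
    also have "\<dots> \<le> (\<Sum>u\<in>{v, b}. x u) + (\<Sum>u\<in>U0. x u)"
    proof -
      have "insert v (N v \<union> U0) = {v, b} \<union> U0" using b by auto
      moreover have "(\<Sum>u\<in>{v, b} \<union> U0. x u) + (\<Sum>u\<in>{v, b} \<inter> U0. x u) = (\<Sum>u\<in>{v, b}. x u) + (\<Sum>u\<in>U0. x u)"
        using finU0 by (intro sum.union_inter) auto
      moreover have "0 \<le> (\<Sum>u\<in>{v, b} \<inter> U0. x u)" by (intro sum_nonneg x_nonneg)
      ultimately show ?thesis by simp
    qed
    also have "(\<Sum>u\<in>{v, b}. x u) \<le> (\<Sum>u\<in>{v, b}. 1)"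
      using x_le_1 U_sub vU \<open>b \<in> U\<close> by (intro sum_mono) auto
    also have "\<dots> \<le> 2" by (simp add: card_insert_if)
    finally have "l \<le> 2 + (\<Sum>u\<in>U0. x u)" by simp
    then show False using D nonneg deficit_less_2 l_ge_5 by simp
  qed
  then have "2 \<le> d v" using vU by simp
  then show ?thesis using D Y by (intro that[OF v EU _ Y U]) simp_all
qed

text \<open>It remains to show that \<open>W\<close> is empty. Each edge from \<open>U\<close> to
  \<open>W\<close> costs at least 4/5 on top of the star, so there is at most one. This one exceeds
  a deficit below 3/2; otherwise \<open>m\<close> is odd, and parity forces further cost from
  \<open>U0\<close>.\<close>

lemma fan_structure:
  assumes no_isolated: "\<And>u. u \<in> V \<Longrightarrow> \<exists>v. (u, v) \<in> E" and m: "card E = 2 * m"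
    and m_deficit: "odd m \<or> deficit < 3 / 2"
  obtains v L P where "V = insert z (insert v (L \<union> P))" "distinct [z, v]" "z \<notin> L \<union> P" "v \<notin> L \<union> P"
    "L \<inter> P = {}" "E = fan_arcs z v L P" "2 \<le> card L"
proof -
  obtain v where v: "center v" and EU: "EU = star v" and dv: "2 \<le> d v" and Y: "Y = {}"
    and U: "U = insert v (N v \<union> U0)"
    and D: "deficit = 1 + (real (d v) - 1) * (1 - x v) + (\<Sum>u\<in>U0. x u) + (\<Sum>(u, w)\<in>X. 1 - x w)"
    by (rule star_structure)
  have vU: "v \<in> U" using v by (simp add: center_def)
  have rest: "0 \<le> (real (d v) - 1) * (1 - x v)"
    using dv x_le_1 U_sub vU by (auto intro!: mult_nonneg_nonneg)
  have disj: "v \<notin> N v \<union> U0" "N v \<inter> U0 = {}"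
    using irrefl dv v by (auto simp: N_def U0_def center_def)
  have W_nbrs: "y \<in> U" if "w \<in> W" "(w, y) \<in> E" for w y
  proof -
    have "y \<noteq> z" "y \<notin> W" using zW(2)[OF that(1)] that Y by (auto simp: Y_def)
    then show ?thesis using in_V(2)[OF that(2)] V_eq by auto
  qed
  \<comment> \<open>All neighbours of \<open>w\<close> lie in \<open>U\<close>. If they lie in
    \<open>U0\<close>, the deficit bounds their sum by 1. If one lies outside \<open>U0\<close>, it
    is the only one: by \<open>W_nbr\<close> a second would form with it an isolated edge of
    \<open>U\<close>, but the star has at least two leaves. So
    \<open>l * x w \<le> 1\<close>.\<close>
  have x_W: "x w \<le> 1 / 5" if w: "w \<in> W" for w
  proof -
    have eig: "l * x w = (\<Sum>y\<in>E `` {w}. x y)" using eigen W_sub w by auto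
    have "l * x w \<le> 1"
    proof (cases "E `` {w} \<subseteq> U0")
      case True
      have "l * x w \<le> (\<Sum>u\<in>U0. x u)" unfolding eig using True finU0 x_nonneg by (intro sum_mono2) auto
      also have "\<dots> \<le> 1"
      proof -
        have "0 \<le> (\<Sum>(u, w)\<in>X. 1 - x w)" using x_le_1 W_sub by (auto intro!: sum_nonneg simp: X_def)
        then show ?thesis using D rest deficit_less_2 by simp
      qed
      finally show ?thesis .
    next
      case False
      then obtain a where a: "(w, a) \<in> E" "a \<notin> U0" by auto
      have aU: "a \<in> U" using W_nbrs w a by simp
      have "y = a" if y: "(w, y) \<in> E" for y
      proof (rule ccontr)
        assume ya: "y \<noteq> a"
        have yU: "y \<in> U" using W_nbrs w y by simp
        have "N a \<subseteq> {y}" using W_nbr[OF w _ a(1) y yU ya] aU by (auto simp: EU_iff)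
        moreover have "N a \<noteq> {}" using a(2) aU by (auto simp: U0_def d_def)
        ultimately have Na: "N a = {y}" by auto
        then have ya_EU: "(y, a) \<in> EU" using EU_sym[of a y] aU by (auto simp: EU_iff)
        have "N y \<subseteq> {a}" using W_nbr[OF w _ y a(1) aU ya[symmetric]] yU by (auto simp: EU_iff)
        then have "N y = {a}" using ya_EU by (auto simp: EU_iff)
        then have "d a = 1" "d y = 1" using Na by (auto simp: d_def)
        moreover have "(y, a) \<in> star v" using ya_EU EU by simp
        then have "y = v \<or> a = v" by (auto simp: star_def)
        ultimately show False using dv by auto
      qed
      then have "E `` {w} = {a}" using a by blast
      then show ?thesis using eig x_le_1 aU U_sub by auto
    qed
    moreover have "5 * x w \<le> l * x w" using l_ge_5 x_nonneg by (intro mult_right_mono) auto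
    ultimately show ?thesis by simp
  qed
  have "4 / 5 * card X \<le> (\<Sum>(u, w)\<in>X. 1 - x w)"
  proof -
    have "(\<Sum>e\<in>X. 4 / 5) \<le> (\<Sum>(u, w)\<in>X. 1 - x w)" using x_W by (intro sum_mono) (auto simp: X_def)
    then show ?thesis by simp
  qed
  then have card_X: "4 / 5 * card X \<le> deficit - 1 - (real (d v) - 1) * (1 - x v) - (\<Sum>u\<in>U0. x u)" using D by simp
  have "W = {}"
  proof (rule ccontr)
    assume "W \<noteq> {}"
    then obtain w where w: "w \<in> W" by blast
    then obtain u where u: "(w, u) \<in> E" using no_isolated W_sub by blast
    then have uX: "(u, w) \<in> X" and uU: "u \<in> U" using W_nbrs w by (auto simp: X_def sym_iff)
    have "card X < 2"
    proof -
      have "4 / 5 * real (card X) < 1"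
        using card_X rest sum_U0_nonneg deficit_less_2 by linarith
      then show ?thesis by simp
    qed
    then have "card X \<le> Suc 0" by simp
    then have X: "X = {(u, w)}" using card_le_Suc0_iff_eq[OF finX(2)] uX by blast
    have "E `` {w} = {u}"
    proof -
      have "y = u" if "(w, y) \<in> E" for y
      proof -
        have "(y, w) \<in> X" using W_nbrs[OF w that] that w by (simp add: X_def sym_iff)
        then show ?thesis using X by simp
      qed
      then show ?thesis using u by blast
    qed
    then have xw: "l * x w = x u" using eigen[of w] W_sub w by auto
    show False
    proof (cases "deficit < 3 / 2")
      case True
      then show ?thesis using D X x_W[OF w] rest sum_U0_nonneg by simp
    next
      case False
      then have "odd m" using m_deficit by simp
      \<comment> \<open>The star costs at least 1 and the single edge to \<open>w\<close> costs
        \<open>1 - x w\<close>, so less than \<open>x w\<close> is left for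
        \<open>U0\<close>.\<close>
      have less: "(\<Sum>u\<in>U0. x u) < x w" using D X rest deficit_less_2 by simp
      have le: "x w \<le> x p" if "l * x w \<le> l * x p" for p using that l_ge_5 by simp
      have "x w \<le> (\<Sum>u\<in>U0. x u)"
      proof (cases "u \<in> U0")
        case True
        have "x w \<le> l * x w" using l_ge_5 x_nonneg[of w] by (simp add: mult_le_cancel_right1)
        also have "\<dots> \<le> (\<Sum>u\<in>U0. x u)" unfolding xw using True finU0 x_nonneg by (intro member_le_sum) auto
        finally show ?thesis .
      next
        case False
        \<comment> \<open>Counting edges gives \<open>m = 2 * d v + 2 + card U0\<close>, so for odd
          \<open>m\<close> there is some \<open>p\<close> in \<open>U0\<close>. Its only neighbour
          is \<open>z\<close>, hence \<open>l * x p = 1\<close>, which is at least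
          \<open>x u = l * x w\<close>.\<close>
        have "card U = 1 + (d v + card U0)"
          using disj finN finU0 unfolding d_def by (subst U) (simp add: card_Un_disjoint)
        moreover have "card EU = 2 * d v"
        proof -
          have "({v} \<times> N v) \<inter> (N v \<times> {v}) = {}" using disj by auto
          then show ?thesis unfolding EU star_def using finN by (simp add: card_Un_disjoint card_cartesian_product d_def)
        qed
        ultimately have "m = 2 * d v + 2 + card U0" using card_E m X Y by simp
        then have "card U0 \<noteq> 0" using \<open>odd m\<close> by (auto intro: odd_pos)
        then obtain p where p: "p \<in> U0" by fastforce
        then have pU: "p \<in> U" "N p = {}" using finN by (auto simp: U0_def d_def)
        moreover have "M p = {}"
        proof -
          have "b \<notin> M p" for b
          proof
            assume "b \<in> M p"
            then have "(p, b) \<in> X" using pU by (simp add: X_Sigma[symmetric])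
            then show False using X False p by simp
          qed
          then show ?thesis by blast
        qed
        ultimately have "l * x p = 1" using eigen_U[of p] by simp
        then have "x w \<le> x p" using xw x_le_1[of u] uU U_sub by (intro le) auto
        also have "\<dots> \<le> (\<Sum>u\<in>U0. x u)" using p finU0 x_nonneg by (intro member_le_sum) auto
        finally show ?thesis .
      qed
      then show False using less by simp
    qed
  qed
  then have "X = {}" by (simp add: X_def)
  have V: "V = insert z (insert v (N v \<union> U0))"
  proof -
    have "V = insert z (U \<union> W)" by (rule V_eq)
    also have "U \<union> W = insert v (N v \<union> U0)" using U \<open>W = {}\<close> by simp
    finally show ?thesis .
  qed
  have zv: "z \<notin> insert v (N v \<union> U0)" using z_notin(1) U by simp
  have E_fan: "E = fan_arcs z v (N v) U0"
  proof -
    have "E = {z} \<times> U \<union> (U \<times> {z} \<union> (EU \<union> (X \<union> (X\<inverse> \<union> Y))))" by (rule E_eq)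
    also have "\<dots> = {z} \<times> U \<union> (U \<times> {z} \<union> star v)" using EU \<open>X = {}\<close> Y by simp
    also have "{z} \<times> S \<union> (S \<times> {z} \<union> star v) = fan_arcs z v (N v) U0" if "S = insert v (N v \<union> U0)" for S
      unfolding that by (auto simp: fan_arcs_def star_def Let_def)
    then have "{z} \<times> U \<union> (U \<times> {z} \<union> star v) = fan_arcs z v (N v) U0" using U by blast
    finally show ?thesis .
  qed
  show ?thesis by (rule that[OF V _ _ disj E_fan]) (use zv dv in \<open>auto simp: d_def\<close>)
qed

end

section \<open>The graphs \<open>F\<^sub>m\<^sub>,\<^sub>t\<close> and the extremal theorem\<close>

lemma fan_arcs_nbrs:
  assumes "z \<noteq> v" "z \<notin> L \<union> P" "v \<notin> L \<union> P" "L \<inter> P = {}"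
  shows "fan_arcs z v L P `` {z} = insert v (L \<union> P)" "fan_arcs z v L P `` {v} = insert z L"
    "a \<in> L \<Longrightarrow> fan_arcs z v L P `` {a} = {z, v}" "p \<in> P \<Longrightarrow> fan_arcs z v L P `` {p} = {z}"
  using assms by (auto simp: fan_arcs_def Let_def)

text \<open>Free of concrete vertex names, so that it covers both the structure found in
  \<open>G\<close> and the graph \<open>F_graph m t\<close>.\<close>

locale fan =
  fixes V :: "'a set" and E z v L P
  assumes V: "V = insert z (insert v (L \<union> P))" and E: "E = fan_arcs z v L P"
    and zv: "z \<noteq> v" "z \<notin> L \<union> P" "v \<notin> L \<union> P" "L \<inter> P = {}" and finLP: "finite L" "finite P"
begin

lemma eigen_iff:
  fixes x :: "'a \<Rightarrow> real"
  shows "(\<forall>u\<in>V. (\<Sum>w\<in>E `` {u}. x w) = l * x u) \<longleftrightarrow>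
    x v + (\<Sum>a\<in>L. x a) + (\<Sum>p\<in>P. x p) = l * x z \<and> x z + (\<Sum>a\<in>L. x a) = l * x v \<and>
    (\<forall>a\<in>L. x z + x v = l * x a) \<and> (\<forall>p\<in>P. x z = l * x p)"
proof -
  note N = fan_arcs_nbrs[OF zv]
  have "(\<Sum>w\<in>E `` {z}. x w) = x v + (\<Sum>a\<in>L. x a) + (\<Sum>p\<in>P. x p)"
    unfolding E N(1) using zv finLP by (simp add: sum.union_disjoint)
  moreover have "(\<Sum>w\<in>E `` {v}. x w) = x z + (\<Sum>a\<in>L. x a)"
    unfolding E N(2) using zv finLP by simp
  moreover have "(\<Sum>w\<in>E `` {a}. x w) = x z + x v" if "a \<in> L" for a
    unfolding E N(3)[OF that] using zv by simp
  moreover have "(\<Sum>w\<in>E `` {p}. x w) = x z" if "p \<in> P" for p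
    unfolding E N(4)[OF that] by simp
  ultimately show ?thesis unfolding V by (simp add: ball_Un cong: ball_cong)
qed

text \<open>Eliminating the entries on \<open>L\<close> and \<open>P\<close> leaves a homogeneous linear system in \<open>x z\<close> and
  \<open>x v\<close>, whose determinant is this quartic.\<close>

lemma quartic_det:
  "F_quartic (2 * r + t + 1) t l = (l\<^sup>2 - r - t) * (l\<^sup>2 - r) - (l + r)\<^sup>2"
  by (simp add: F_quartic_def power2_eq_square power4_eq_xxxx field_simps)

text \<open>By Cramer's rule the determinant annihilates both \<open>x z\<close> and
  \<open>x v\<close>. They cannot both vanish, since for \<open>l \<noteq> 0\<close> they determine
  the entries on \<open>L\<close> and \<open>P\<close>.\<close>

lemma quartic_eq_0:
  fixes x :: "'a \<Rightarrow> real"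
  assumes eig: "\<And>u. u \<in> V \<Longrightarrow> (\<Sum>w\<in>E `` {u}. x w) = l * x u" and x: "\<exists>u\<in>V. x u \<noteq> 0" and l: "l \<noteq> 0"
  shows "F_quartic (2 * card L + card P + 1) (card P) l = 0"
proof -
  define r t where "r = card L" and "t = card P"
  have z: "x v + (\<Sum>a\<in>L. x a) + (\<Sum>p\<in>P. x p) = l * x z" and v: "x z + (\<Sum>a\<in>L. x a) = l * x v"
    and L: "\<And>a. a \<in> L \<Longrightarrow> x z + x v = l * x a" and P: "\<And>p. p \<in> P \<Longrightarrow> x z = l * x p"
    using eigen_iff[of x l] eig by blast+
  have "l * (\<Sum>a\<in>L. x a) = (\<Sum>a\<in>L. x z + x v)" unfolding sum_distrib_left using L by (intro sum.cong) auto
  then have sL: "l * (\<Sum>a\<in>L. x a) = r * (x z + x v)" by (simp add: r_def)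
  have "l * (\<Sum>p\<in>P. x p) = (\<Sum>p\<in>P. x z)" unfolding sum_distrib_left using P by (intro sum.cong) auto
  then have sP: "l * (\<Sum>p\<in>P. x p) = t * x z" by (simp add: t_def)
  have "l * (l * x z) = l * x v + r * (x z + x v) + t * x z"
    unfolding z[symmetric] by (simp add: distrib_left sL sP)
  then have 1: "(l\<^sup>2 - r - t) * x z = (l + r) * x v" by (simp add: algebra_simps power2_eq_square)
  have "l * (l * x v) = l * x z + r * (x z + x v)"
    unfolding v[symmetric] by (simp add: distrib_left sL)
  then have 2: "(l\<^sup>2 - r) * x v = (l + r) * x z" by (simp add: algebra_simps power2_eq_square)
  define Q where "Q = (l\<^sup>2 - r - t) * (l\<^sup>2 - r) - (l + r)\<^sup>2"
  have "Q * x z = (l\<^sup>2 - r) * ((l\<^sup>2 - r - t) * x z) - (l + r) * ((l + r) * x z)"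
    by (simp add: Q_def algebra_simps power2_eq_square)
  also have "\<dots> = 0" unfolding 1 2[symmetric] by (simp add: algebra_simps)
  finally have Qz: "Q * x z = 0" .
  have "Q * x v = (l\<^sup>2 - r - t) * ((l\<^sup>2 - r) * x v) - (l + r) * ((l + r) * x v)"
    by (simp add: Q_def algebra_simps power2_eq_square)
  also have "\<dots> = 0" unfolding 2 1[symmetric] by (simp add: algebra_simps)
  finally have Qv: "Q * x v = 0" .
  have "x z \<noteq> 0 \<or> x v \<noteq> 0"
  proof (rule ccontr)
    assume "\<not> ?thesis"
    then have "x z = 0" "x v = 0" by auto
    then have "\<forall>u\<in>V. x u = 0" using L P l unfolding V by force
    then show False using x by blast
  qed
  then have "Q = 0" using Qz Qv by auto
  then show ?thesis using quartic_det[of r t l] by (simp add: Q_def r_def t_def)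
qed

lemma eigenfunction_of_root:
  assumes l: "0 < l" and root: "F_quartic (2 * card L + card P + 1) (card P) l = 0"
  obtains x :: "'a \<Rightarrow> real" where "\<exists>u\<in>V. x u \<noteq> 0"
    "\<And>u. u \<in> V \<Longrightarrow> (\<Sum>w\<in>E `` {u}. x w) = l * x u"
proof -
  define r t where "r = real (card L)" and "t = real (card P)"
  \<comment> \<open>The equation at \<open>v\<close> fixes the ratio of \<open>x z\<close> and
    \<open>x v\<close>; the entries on \<open>L\<close> and \<open>P\<close> are
    \<open>(x z + x v) / l\<close> and \<open>x z / l\<close>. The equation at \<open>z\<close> is
    then the vanishing of the determinant.\<close>
  define x where "x u = (if u = z then l\<^sup>2 - r else if u = v then l + r
    else if u \<in> L then (l\<^sup>2 + l) / l else (l\<^sup>2 - r) / l)" for u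
  have xz: "x z = l\<^sup>2 - r" and xv: "x v = l + r" using zv by (auto simp: x_def)
  have xL: "x a = (l\<^sup>2 + l) / l" if "a \<in> L" for a using that zv by (auto simp: x_def)
  have xP: "x p = (l\<^sup>2 - r) / l" if "p \<in> P" for p using that zv by (auto simp: x_def)
  have sums: "(\<Sum>a\<in>L. x a) = r * ((l\<^sup>2 + l) / l)" "(\<Sum>p\<in>P. x p) = t * ((l\<^sup>2 - r) / l)"
    using xL xP by (simp_all add: r_def t_def)
  have det: "(l\<^sup>2 - r - t) * (l\<^sup>2 - r) = (l + r)\<^sup>2"
    using root quartic_det[of "card L" "card P" l] by (simp add: r_def t_def)
  have "l + r > 0" using l by (simp add: r_def)
  then have "\<exists>u\<in>V. x u \<noteq> 0" using xv by (intro bexI[of _ v]) (auto simp: V)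
  moreover have "\<forall>u\<in>V. (\<Sum>w\<in>E `` {u}. x w) = l * x u"
    unfolding eigen_iff
  proof (intro conjI ballI)
    show "x v + (\<Sum>a\<in>L. x a) + (\<Sum>p\<in>P. x p) = l * x z"
    proof -
      have "(l + r) * l + r * (l\<^sup>2 + l) + t * (l\<^sup>2 - r) = l * (l\<^sup>2 - r) * l"
        using det by (simp add: algebra_simps power2_eq_square)
      moreover have "l + r + r * ((l\<^sup>2 + l) / l) + t * ((l\<^sup>2 - r) / l) =
          ((l + r) * l + r * (l\<^sup>2 + l) + t * (l\<^sup>2 - r)) / l"
        using l by (simp add: field_simps)
      ultimately show ?thesis using l unfolding sums xz xv by simp
    qed
    show "x z + (\<Sum>a\<in>L. x a) = l * x v"
      using l unfolding sums xz xv by (simp add: field_simps power2_eq_square)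
  qed (use l in \<open>simp_all add: xz xv xL xP field_simps\<close>)
  ultimately show ?thesis using that by blast
qed

end

section \<open>Fans up to isomorphism and the spectral radius of F_{m,t}\<close>

lemma image_pair_converse: "(\<lambda>(u, v). (h u, h v)) ` (K\<inverse>) = ((\<lambda>(u, v). (h u, h v)) ` K)\<inverse>"
  by auto

lemma fan_isomorphic:
  assumes "fan (pverts G) (parcs G) z v L P" "fan (pverts H) (parcs H) z' v' L' P'"
    and card: "card L = card L'" "card P = card P'"
  shows "isomorphic G H"
proof -
  interpret G: fan "pverts G" "parcs G" z v L P by fact
  interpret H: fan "pverts H" "parcs H" z' v' L' P' by fact
  obtain f where f: "bij_betw f L L'" using finite_same_card_bij G.finLP H.finLP card by blast
  obtain g where g: "bij_betw g P P'" using finite_same_card_bij G.finLP H.finLP card by blast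
  define h where "h u = (if u = z then z' else if u = v then v' else if u \<in> L then f u else g u)" for u
  have hz: "h z = z'" "h v = v'" using G.zv by (auto simp: h_def)
  have hL: "h ` L = L'" "inj_on h L"
    using f G.zv by (auto simp: bij_betw_def h_def inj_on_def image_iff)
  have hP: "h ` P = P'" "inj_on h P"
    using g G.zv by (auto simp: bij_betw_def h_def inj_on_def image_iff)
  have img: "h ` pverts G = pverts H" unfolding G.V H.V by (simp add: hz image_Un hL hP)
  have "inj_on h (L \<union> P)"
    using hL hP H.zv by (simp add: inj_on_Un) blast
  then have "inj_on h (pverts G)"
    unfolding G.V using G.zv H.zv by (simp add: hz image_Un hL hP)
  then have "bij_betw h (pverts G) (pverts H)" using img by (simp add: bij_betw_def)
  moreover have "parcs H = (\<lambda>(u, v). (h u, h v)) ` parcs G"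
  proof -
    have K: "(\<lambda>(u, v). (h u, h v)) ` (A \<times> B) = h ` A \<times> h ` B" for A B by auto
    show ?thesis
      unfolding G.E H.E fan_arcs_def Let_def image_Un image_pair_converse K
      by (simp add: hz image_Un hL hP)
  qed
  moreover have "pair_wf_digraph G"
    by unfold_locales (auto simp: G.V G.E fan_arcs_def Let_def)
  ultimately show ?thesis using isomorphic_iff by blast
qed

text \<open>The form of \<open>m\<close> makes the division in \<open>F_graph\<close> exact, with
  \<open>n = r + 2\<close>; the hubs are 0 and 1.\<close>

lemma F_graph_fan:
  assumes "m = 2 * r + t + 1"
  shows "fan (pverts (F_graph m t)) (parcs (F_graph m t)) 0 1 {2..<r + 2} {r + 2..<r + 2 + t}"
proof -
  have n: "(m - t + 3) div 2 = r + 2" using assms by simp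
  then have F: "F_graph m t = \<lparr>pverts = {..<r + 2} \<union> {r + 2..<r + 2 + t},
      parcs = {(i, j). i < r + 2 \<and> j < r + 2 \<and> i \<noteq> j \<and> (i < 2 \<or> j < 2)} \<union>
        {0} \<times> {r + 2..<r + 2 + t} \<union> {r + 2..<r + 2 + t} \<times> {0}\<rparr>"
    unfolding F_graph_def S_graph_def Let_def n by simp
  show ?thesis
  proof
    show "pverts (F_graph m t) = insert 0 (insert 1 ({2..<r + 2} \<union> {r + 2..<r + 2 + t}))"
      by (auto simp: F)
    show "parcs (F_graph m t) = fan_arcs 0 1 {2..<r + 2} {r + 2..<r + 2 + t}"
    proof -
      have two: "k < 2 \<longleftrightarrow> k = 0 \<or> k = 1" for k :: nat by auto
      have "(i, j) \<in> parcs (F_graph m t) \<longleftrightarrow> (i, j) \<in> fan_arcs 0 1 {2..<r + 2} {r + 2..<r + 2 + t}" for i j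
        by (auto simp: F fan_arcs_def Let_def two)
      then show ?thesis by (simp add: set_eq_iff split_paired_All)
    qed
  qed auto
qed

text \<open>The excluded graph is thus the member without pendant vertices of the same
  family.\<close>

lemma S_graph_eq_F_graph: "S_graph ((m + 3) div 2) 2 = F_graph m 0"
  by (simp add: F_graph_def S_graph_def Let_def)

text \<open>Intermediate value theorem: the quartic is nonnegative far to the right, so a
  nonpositive value forces a root at or beyond \<open>y\<close>.\<close>

lemma F_quartic_root_ge:
  assumes "t + 1 \<le> m" and "F_quartic m t y \<le> 0"
  obtains b where "y \<le> b" "F_quartic m t b = 0"
proof -
  \<comment> \<open>From \<open>m + 2\<close> on, \<open>B * B - m\<close> is at least 1, so the
    cubic term outweighs the constant \<open>c \<le> m\<close>.\<close>
  define B where "B = max y (real m + 2)"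
  have B: "B \<ge> real m + 2" "y \<le> B" by (auto simp: B_def)
  define c where "c = real m - real t - 1"
  have c: "0 \<le> c" "c \<le> m" using assms(1) by (auto simp: c_def)
  have "1 * B \<le> B * B" using B by (intro mult_right_mono) auto
  then have "1 \<le> B * B - m" using B by linarith
  then have "B * 1 \<le> B * (B * B - m)" using B by (intro mult_left_mono) auto
  then have "0 \<le> B * (B * B - m) - c" using B c by linarith
  then have "0 \<le> B * (B * (B * B - m) - c) + real t / 2 * c" using B c by (intro add_nonneg_nonneg mult_nonneg_nonneg) auto
  also have "\<dots> = F_quartic m t B" by (simp add: F_quartic_def c_def algebra_simps power2_eq_square power4_eq_xxxx)
  finally have "0 \<le> F_quartic m t B" .
  moreover have "continuous_on {y..B} (F_quartic m t)"
    unfolding F_quartic_def by (intro continuous_intros)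
  ultimately show ?thesis
    using IVT'[of "F_quartic m t" y 0 B] assms(2) B that by blast
qed

lemma rho_F_graph:
  assumes m: "m = 2 * r + t + 1" and t: "t \<le> 4"
  shows "is_largest_root (F_quartic m t) (rho (F_graph m t))" "1 \<le> rho (F_graph m t)"
proof -
  let ?F = "F_graph m t"
  interpret fan "pverts ?F" "parcs ?F" 0 1 "{2..<r + 2}" "{r + 2..<r + 2 + t}"
    by (rule F_graph_fan[OF m])
  have fin: "finite (pverts ?F)" "pverts ?F \<noteq> {}" using V finLP by simp_all
  have arcs: "parcs ?F \<subseteq> pverts ?F \<times> pverts ?F" "Relation.sym (parcs ?F)"
    unfolding E V by (auto simp: fan_arcs_def Let_def sym_def)
  have root_le: "y \<le> rho ?F" if y: "0 < y" "F_quartic m t y = 0" for y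
  proof -
    have root: "F_quartic (2 * card {2..<r + 2} + card {r + 2..<r + 2 + t} + 1) (card {r + 2..<r + 2 + t}) y = 0"
      using y(2) by (simp add: m)
    obtain x :: "nat \<Rightarrow> real" where "\<exists>u\<in>pverts ?F. x u \<noteq> 0"
      "\<And>u. u \<in> pverts ?F \<Longrightarrow> (\<Sum>w\<in>parcs ?F `` {u}. x w) = y * x u"
      using eigenfunction_of_root[OF y(1) root] by blast
    then have "\<bar>y\<bar> \<le> rho ?F" by (rule abs_le_rho[OF fin arcs(1)])
    then show ?thesis by simp
  qed
  \<comment> \<open>At 1 the quartic equals \<open>t * r - 4 * r - t\<close>, which is where
    \<open>t \<le> 4\<close> enters. The resulting root at or above 1 keeps the spectral radius away
    from 0.\<close>
  have "real t * real r \<le> 4 * real r" using t by (intro mult_right_mono) auto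
  then have "F_quartic m t 1 \<le> 0" by (simp add: F_quartic_def m algebra_simps)
  then obtain b where "1 \<le> b" "F_quartic m t b = 0" using F_quartic_root_ge[of t m 1] m by auto
  then show ge1: "1 \<le> rho ?F" using root_le[of b] by simp
  obtain x :: "nat \<Rightarrow> real" where "\<And>u. 0 \<le> x u" "\<exists>u\<in>pverts ?F. x u \<noteq> 0"
      "\<And>u. u \<in> pverts ?F \<Longrightarrow> (\<Sum>w\<in>parcs ?F `` {u}. x w) = rho ?F * x u"
    using rho_eigenfunction[OF fin arcs] by blast
  moreover have "rho ?F \<noteq> 0" using ge1 by simp
  ultimately have "F_quartic (2 * card {2..<r + 2} + card {r + 2..<r + 2 + t} + 1)
      (card {r + 2..<r + 2 + t}) (rho ?F) = 0"
    using quartic_eq_0 by blast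
  then have "F_quartic m t (rho ?F) = 0" unfolding m by simp
  moreover have "y \<le> rho ?F" if "F_quartic m t y = 0" for y
    using root_le[of y] that ge1 by (cases "0 < y") auto
  ultimately show "is_largest_root (F_quartic m t) (rho ?F)" by (simp add: is_largest_root_def)
qed

section \<open>Arc configurations and edge counts of the given graph\<close>

lemma theta_123_free:
  assumes G: "pair_graph G" and free: "graph_free (theta 1 2 3) G"
    and arcs: "(a, b) \<in> parcs G" "(a, c) \<in> parcs G" "(c, b) \<in> parcs G"
      "(a, d) \<in> parcs G" "(d, e) \<in> parcs G" "(e, b) \<in> parcs G"
    and dist: "distinct [a, b, c, d, e]"
  shows False
proof -
  interpret pair_graph G by fact
  define H where "H = \<lparr>pverts = {a, b, c, d, e},
    parcs = (let K = {(a, b), (a, c), (c, b), (a, d), (d, e), (e, b)} in K \<union> K\<inverse>)\<rparr>"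
  have sym: "(s, t) \<in> parcs G \<Longrightarrow> (t, s) \<in> parcs G" for s t
    using pair_sym_arcs by (auto simp: symmetric_def sym_def)
  have H_arcs: "parcs H \<subseteq> parcs G"
    using arcs arcs[THEN sym] by (auto simp: H_def Let_def)
  have H_verts: "pverts H \<subseteq> pverts G"
    using arcs in_arcsD1 in_arcsD2 by (auto simp: H_def)
  have wf: "pair_wf_digraph H" by unfold_locales (auto simp: H_def Let_def)
  then interpret H: pair_wf_digraph H .
  have "subgraph (with_proj H) (with_proj G)"
    unfolding subgraph_def compatible_def
    using H_arcs H_verts wf_digraph H.wf_digraph by simp
  moreover have "isomorphic H (theta 1 2 3)"
    unfolding isomorphic_iff[OF wf]
  proof (intro exI conjI)
    \<comment> \<open>Labels as in \<open>theta\<close>: endpoints 0 and 1, then 2 on the path of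
      length two, 3 and 4 on the path of length three. The default value 4 is the label of
      \<open>e\<close>.\<close>
    let ?f = "(\<lambda>_. 4 :: nat)(a := 0, b := 1, c := 2, d := 3)"
    have T: "pverts (theta 1 2 3) = {0, 1, 2, 3, 4}"
      "parcs (theta 1 2 3) = (let K = {(0, 1), (0, 2), (2, 1), (0, 3), (3, 4), (4, 1)} in K \<union> K\<inverse>)"
      by (auto simp: theta_def path_arcs_def Let_def upt_rec numeral_eq_Suc)
    show "bij_betw ?f (pverts H) (pverts (theta 1 2 3))"
      unfolding T using dist by (auto simp: bij_betw_def H_def inj_on_def)
    have f: "?f a = 0" "?f b = 1" "?f c = 2" "?f d = 3" "?f e = 4" using dist by auto
    have "parcs H = (let K = {(a, b), (a, c), (c, b), (a, d), (d, e), (e, b)} in K \<union> K\<inverse>)"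
      by (simp add: H_def)
    then show "parcs (theta 1 2 3) = (\<lambda>(u, v). (?f u, ?f v)) ` parcs H"
      unfolding T Let_def by (simp only: image_Un image_pair_converse image_insert image_empty prod.case f)
  qed
  ultimately show False using free by (auto simp: graph_free_def)
qed

text \<open>Sending an arc to its edge has fibres of size two, by symmetry and the absence of
  loops.\<close>

lemma card_parcs:
  assumes "pair_graph G"
  shows "card (parcs G) = 2 * card (edge_set G)"
proof -
  interpret pair_graph G by fact
  have sym: "(s, t) \<in> parcs G \<Longrightarrow> (t, s) \<in> parcs G" for s t
    using pair_sym_arcs by (auto simp: symmetric_def sym_def)
  define A where "A e = {p \<in> parcs G. {fst p, snd p} = e}" for e
  have edges: "edge_set G = (\<lambda>p. {fst p, snd p}) ` parcs G"
    by (auto simp: edge_set_def image_iff) (metis fst_conv snd_conv)+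
  have "parcs G = (\<Union>e\<in>edge_set G. A e)" by (auto simp: A_def edges)
  then have "card (parcs G) = card (\<Union>e\<in>edge_set G. A e)" by simp
  also have "\<dots> = (\<Sum>e\<in>edge_set G. card (A e))"
    using pair_finite_arcs by (intro card_UN_disjoint) (auto simp: edges A_def)
  also have "\<dots> = (\<Sum>e\<in>edge_set G. 2)"
  proof (rule sum.cong[OF refl])
    fix e assume "e \<in> edge_set G"
    then obtain u v where uv: "(u, v) \<in> parcs G" "e = {u, v}" by (auto simp: edge_set_def)
    then have "A e = {(u, v), (v, u)}" using sym by (auto simp: A_def doubleton_eq_iff)
    moreover have "u \<noteq> v" using pair_no_loops[OF uv(1)] by simp
    ultimately show "card (A e) = 2" by simp
  qed
  finally show ?thesis by simp
qed

section \<open>From the quartic inequality to the extremal graph\<close>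

lemma deficit_bound:
  fixes s :: real
  assumes m: "22 \<le> m" and t: "t = 1 \<or> t = 2" and s: "1 \<le> s" and f: "0 \<le> F_quartic m t s"
  shows "m - (s\<^sup>2 - s) < 1 + t / 2" "5 \<le> s"
proof -
  \<comment> \<open>The first factor is \<open>1 + t / 2\<close> minus the deficit, the second is
    positive, and a positive square is subtracted; a nonnegative quartic therefore forces a positive
    first factor.\<close>
  have "F_quartic m t s = (1 + real t / 2 - (m - (s\<^sup>2 - s))) * (s\<^sup>2 + s - real t / 2) - (real t / 2)\<^sup>2"
    by (simp add: F_quartic_def power2_eq_square power4_eq_xxxx field_simps)
  moreover have "0 < (real t / 2)\<^sup>2" using t by auto
  ultimately have prod: "0 < (1 + real t / 2 - (m - (s\<^sup>2 - s))) * (s\<^sup>2 + s - real t / 2)" using f by linarith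
  have "1 \<le> s\<^sup>2" using s by simp
  moreover have "real t \<le> 2" using t by auto
  ultimately have pos: "0 < s\<^sup>2 + s - real t / 2" using s by linarith
  show D: "m - (s\<^sup>2 - s) < 1 + t / 2" using zero_less_mult_pos2[OF prod pos] by simp
  \<comment> \<open>The role of \<open>m \<ge> 22\<close>: the deficit is below 2, and
    \<open>20 = 5 * 4\<close>.\<close>
  have "20 < s\<^sup>2 - s" using D m t by auto
  show "5 \<le> s"
  proof (rule ccontr)
    assume "\<not> ?thesis"
    then have "s * (s - 1) \<le> 5 * 4" using s by (intro mult_mono) auto
    then show False using \<open>20 < s\<^sup>2 - s\<close> by (simp add: power2_eq_square algebra_simps)
  qed
qed

text \<open>The value \<open>F_quartic m s l\<close> differs from \<open>F_quartic m 0 l\<close> by \<open>s l + s (m - s - 1) / 2\<close>,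
  and \<open>s (m - s - 1)\<close> does not drop below \<open>t (m - t - 1)\<close> as long as \<open>s \<le> m - t - 1\<close>.\<close>

lemma F_quartic_mono:
  fixes l :: real
  assumes "t < s" "s + t + 1 \<le> m" "0 < l"
  shows "F_quartic m t l < F_quartic m s l"
proof -
  have "F_quartic m s l - F_quartic m t l = (real s - t) * (l + (m - real s - t - 1) / 2)"
    by (simp add: F_quartic_def field_simps)
  also have "\<dots> > 0" using assms by (intro mult_pos_pos add_pos_nonneg) auto
  finally show ?thesis by simp
qed

text \<open>The sign condition on the quartic expresses that \<open>rho G\<close> is not below its
  largest root. Scaling an eigenfunction to maximum 1 puts \<open>G\<close> into the locale, whose
  conclusion makes it a fan; it remains to determine the number of pendant vertices.\<close>

lemma isomorphic_F_graph:
  fixes G :: "'a pair_pre_digraph"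
  assumes G: "G \<in> free_graphs m (theta 1 2 3)" and m: "22 \<le> m"
    and t: "t = 1 \<and> even m \<or> t = 2 \<and> odd m" and not_S: "odd m \<Longrightarrow> \<not> isomorphic G (S_graph ((m + 3) div 2) 2)"
    and rho: "1 \<le> rho G" "0 \<le> F_quartic m t (rho G)"
  shows "isomorphic G (F_graph m t)"
proof -
  have pg: "pair_graph G" and ni: "no_isolated G" and cm: "card (edge_set G) = m"
    and free: "graph_free (theta 1 2 3) G" using G by (auto simp: free_graphs_def)
  interpret pair_graph G by fact
  have sym: "(a, b) \<in> parcs G \<Longrightarrow> (b, a) \<in> parcs G" for a b
    using pair_sym_arcs by (auto simp: symmetric_def sym_def)
  have card: "card (parcs G) = 2 * m" using card_parcs[OF pg] cm by simp
  have arcs: "parcs G \<subseteq> pverts G \<times> pverts G" "Relation.sym (parcs G)"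
    using in_arcsD1 in_arcsD2 sym by (auto simp: sym_def)
  have "parcs G \<noteq> {}" using card m by auto
  then have ne: "pverts G \<noteq> {}" using arcs by auto
  obtain y :: "'a \<Rightarrow> real" where y: "\<And>u. 0 \<le> y u" "\<exists>u\<in>pverts G. y u \<noteq> 0"
    and eig: "\<And>u. u \<in> pverts G \<Longrightarrow> (\<Sum>v\<in>parcs G `` {u}. y v) = rho G * y u"
    using rho_eigenfunction[OF pair_finite_verts ne arcs] by blast
  obtain z where z: "z \<in> pverts G" "\<And>u. u \<in> pverts G \<Longrightarrow> y u \<le> y z"
  proof -
    obtain z where "z \<in> pverts G" "y z = Max (y ` pverts G)"
      by (rule obtains_MAX[OF pair_finite_verts ne, of y]) simp
    then show ?thesis using pair_finite_verts by (intro that[of z]) auto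
  qed
  obtain u where "u \<in> pverts G" "y u \<noteq> 0" using y(2) by blast
  then have yz: "0 < y z" using y(1)[of u] z(2)[of u] by simp
  have tt: "t = 1 \<or> t = 2" using t by auto
  have bound: "m - ((rho G)\<^sup>2 - rho G) < 1 + t / 2" "5 \<le> rho G"
    using deficit_bound[OF m tt rho] by auto
  interpret theta_free_eigen "pverts G" "parcs G" "\<lambda>u. y u / y z" "rho G" z
  proof
    show "(\<Sum>v\<in>parcs G `` {u}. y v / y z) = rho G * (y u / y z)" if "u \<in> pverts G" for u
      using eig[OF that] by (simp flip: sum_divide_distrib)
    show "real (card (parcs G)) / 2 - ((rho G)\<^sup>2 - rho G) < 2" using bound tt card by auto
    show "False" if "(a, b) \<in> parcs G" "(a, c) \<in> parcs G" "(c, b) \<in> parcs G" "(a, d) \<in> parcs G"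
      "(d, e) \<in> parcs G" "(e, b) \<in> parcs G" "distinct [a, b, c, d, e]" for a b c d e
      using that by (rule theta_123_free[OF pg free])
    show "(a, a) \<notin> parcs G" for a using pair_no_loops[of "(a, a)"] by auto
    show "y u / y z \<le> 1" if "u \<in> pverts G" for u using z(2)[OF that] yz by simp
    show "0 \<le> y u / y z" for u using y(1) by simp
    show "5 \<le> rho G" by fact
  qed (use yz in \<open>simp_all add: pair_finite_verts arcs(1) sym z(1)\<close>)
  have D: "deficit = m - ((rho G)\<^sup>2 - rho G)" by (simp add: deficit_def card)
  \<comment> \<open>For even \<open>m\<close> one has \<open>t = 1\<close>, so the bound
    \<open>1 + t / 2\<close> is 3/2.\<close>
  have "odd m \<or> deficit < 3 / 2" using bound t D by auto
  moreover have "\<exists>v. (u, v) \<in> parcs G" if "u \<in> pverts G" for u using ni that by (auto simp: no_isolated_def)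
  ultimately obtain v L P where VE: "pverts G = insert z (insert v (L \<union> P))" "distinct [z, v]" "z \<notin> L \<union> P"
    "v \<notin> L \<union> P" "L \<inter> P = {}" "parcs G = fan_arcs z v L P"
    and L: "2 \<le> card L"
    using fan_structure[OF _ card] by blast
  have "finite (L \<union> P)" using pair_finite_verts unfolding VE(1) by simp
  then interpret G: fan "pverts G" "parcs G" z v L P
    using VE by unfold_locales auto
  define r s where "r = card L" and "s = card P"
  have "card (fan_arcs z v L P) = 2 * (2 * r + s + 1)"
  proof -
    let ?K = "{z} \<times> insert v (L \<union> P) \<union> {v} \<times> L"
    have "card ?K = 2 * r + s + 1"
      using G.zv G.finLP by (subst card_Un_disjoint) (auto simp: card_cartesian_product card_Un_disjoint r_def s_def)
    moreover have "?K \<inter> ?K\<inverse> = {}" using G.zv by auto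
    then have "card (?K \<union> ?K\<inverse>) = card ?K + card (?K\<inverse>)" using G.finLP by (intro card_Un_disjoint) auto
    moreover have "card (?K\<inverse>) = card ?K" by simp
    ultimately show ?thesis by (simp add: fan_arcs_def Let_def)
  qed
  then have mrs: "m = 2 * r + s + 1" using card VE(6) by simp
  have iso: "isomorphic G (F_graph m s)"
    by (rule fan_isomorphic[OF G.fan_axioms F_graph_fan[OF mrs]]) (simp_all add: r_def s_def)
  \<comment> \<open>Parity and the exclusion of \<open>s = 0\<close> for odd \<open>m\<close> leave
    only \<open>s > t\<close>. Then the quartic for \<open>s\<close> vanishes at
    \<open>rho G\<close> although it strictly exceeds the nonnegative quartic for
    \<open>t\<close>.\<close>
  have "s = t"
  proof (rule ccontr)
    assume "s \<noteq> t"
    moreover have "s \<noteq> 0" if "odd m"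
      using iso not_S[OF that] unfolding S_graph_eq_F_graph by metis
    moreover have "odd s \<longleftrightarrow> even m" using mrs by simp
    moreover have "2 \<le> r" using L by (simp add: r_def)
    ultimately have "t < s" using t by presburger
    moreover have "s + t + 1 \<le> m" using \<open>2 \<le> r\<close> t mrs by presburger
    moreover have "F_quartic m s (rho G) = 0"
      using G.quartic_eq_0[OF eig y(2)] rho(1) mrs by (simp add: r_def s_def)
    ultimately show False using F_quartic_mono[of t s m "rho G"] rho by simp
  qed
  then show ?thesis using iso by simp
qed

text \<open>Both the bound and the equality case follow from one implication: \<open>rho G\<close>
  reaches \<open>rho (F_graph m t)\<close> only if the graphs are isomorphic.\<close>

lemma extremal:
  fixes G :: "'a pair_pre_digraph"
  assumes G: "G \<in> free_graphs m (theta 1 2 3)" and m: "22 \<le> m"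
    and t: "t = 1 \<and> even m \<or> t = 2 \<and> odd m" and not_S: "odd m \<Longrightarrow> \<not> isomorphic G (S_graph ((m + 3) div 2) 2)"
  shows "rho G \<le> rho (F_graph m t) \<and> (rho G = rho (F_graph m t) \<longleftrightarrow> isomorphic G (F_graph m t))"
proof -
  interpret pair_graph G using G by (simp add: free_graphs_def)
  have "m = 2 * ((m - t - 1) div 2) + t + 1" using t m by (auto; presburger)
  note F = rho_F_graph[OF this]
  have root: "is_largest_root (F_quartic m t) (rho (F_graph m t))" and ge1: "1 \<le> rho (F_graph m t)"
    using F t by auto
  have iso_eq: "rho G = rho (F_graph m t)" if "isomorphic G (F_graph m t)"
    using rho_isomorphic that pair_finite_verts pair_wf_digraph_axioms by blast
  have "isomorphic G (F_graph m t)" if ge: "rho (F_graph m t) \<le> rho G"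
  proof (rule isomorphic_F_graph[OF G m t not_S])
    show "0 \<le> F_quartic m t (rho G)"
    proof (rule ccontr)
      assume "\<not> ?thesis"
      \<comment> \<open>A negative value would give a root at or beyond \<open>rho G\<close>, which
        is at least the largest root; so \<open>rho G\<close> would itself be a root, a
        contradiction.\<close>
      then have "F_quartic m t (rho G) \<le> 0" "t + 1 \<le> m" using t m by auto
      then obtain b where b: "rho G \<le> b" "F_quartic m t b = 0"
        using F_quartic_root_ge by blast
      moreover from b have "b \<le> rho (F_graph m t)" using root by (simp add: is_largest_root_def)
      ultimately have "rho G = b" using ge by simp
      then show False using \<open>F_quartic m t b = 0\<close> \<open>\<not> 0 \<le> F_quartic m t (rho G)\<close> by simp
    qed
  qed (use ge ge1 in auto)
  then show ?thesis using iso_eq by fastforce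
qed

theorem theorem1p5:
  fixes m :: nat
  assumes "m \<ge> 22"
  shows "(\<forall>G :: 'a pair_pre_digraph.
            G \<in> free_graphs m (theta 1 2 3) \<and>
            (odd m \<longrightarrow> \<not> isomorphic G (S_graph ((m + 3) div 2) 2)) \<longrightarrow>
              (even m \<longrightarrow> rho G \<le> rho (F_graph m 1) \<and>
                           (rho G = rho (F_graph m 1) \<longleftrightarrow> isomorphic G (F_graph m 1))) \<and>
              (odd m \<longrightarrow> rho G \<le> rho (F_graph m 2) \<and>
                          (rho G = rho (F_graph m 2) \<longleftrightarrow> isomorphic G (F_graph m 2)))) \<and>
         (even m \<longrightarrow> is_largest_root (F_quartic m 1) (rho (F_graph m 1))) \<and>
         (odd m \<longrightarrow> is_largest_root (F_quartic m 2) (rho (F_graph m 2)))"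
proof (intro conjI allI impI)
  show "is_largest_root (F_quartic m 1) (rho (F_graph m 1))" if "even m"
  proof (rule rho_F_graph(1))
    show "m = 2 * ((m - 2) div 2) + 1 + 1" using that assms by presburger
  qed simp
  show "is_largest_root (F_quartic m 2) (rho (F_graph m 2))" if "odd m"
  proof (rule rho_F_graph(1))
    show "m = 2 * ((m - 3) div 2) + 2 + 1" using that assms by presburger
  qed simp
next
  fix G :: "'a pair_pre_digraph"
  assume G: "G \<in> free_graphs m (theta 1 2 3) \<and>
    (odd m \<longrightarrow> \<not> isomorphic G (S_graph ((m + 3) div 2) 2))"
  have bound: "rho G \<le> rho (F_graph m t) \<and> (rho G = rho (F_graph m t) \<longleftrightarrow> isomorphic G (F_graph m t))"
    if "t = 1 \<and> even m \<or> t = 2 \<and> odd m" for t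
    using extremal[OF _ assms that] G by blast
  {
    assume "even m"
    then have t: "1 = (1 :: nat) \<and> even m \<or> 1 = (2 :: nat) \<and> odd m" by simp
    show "rho G \<le> rho (F_graph m 1)" "rho G = rho (F_graph m 1) \<longleftrightarrow> isomorphic G (F_graph m 1)"
      using bound[OF t] by auto
  next
    assume "odd m"
    then have t: "2 = (1 :: nat) \<and> even m \<or> 2 = (2 :: nat) \<and> odd m" by simp
    show "rho G \<le> rho (F_graph m 2)" "rho G = rho (F_graph m 2) \<longleftrightarrow> isomorphic G (F_graph m 2)"
      using bound[OF t] by auto
  }
qed

end
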